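(* There exists a constant $c$ and a polynomial-time algorithm which, given a $\Delta$-disk graph $G$, outputs a subcoloring of $G$ with at most $c\cdot\chi_s(G)$ colors (a constant-factor approximation algorithm for the subchromatic number of $\Delta$-disk graphs).
   Context: A $\Delta$-disk graph is a graph having a representation as the intersection graph of closed disks $D_v$ with centers $(x_v,y_v)$ and radii $r_v$ ($v\in V(G)$) such that for every $v$, $x_v>0$, $y_v>0$ and $\max(x_v,y_v)\leq r_v<\sqrt{x_v^2+y_v^2}$. A subcoloring of $G$ is a partition of $V(G)$ into color classes each inducing a disjoint union of cliques (no induced path on three vertices); $\chi_s(G)$ is the minimum number of colors of a subcoloring. *)

theory Defs
  imports
    "HOL-Analysis.Analysis"
    "HOL-Library.Disjoint_Sets"
    "HOL-Computational_Algebra.Polynomial"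
    "Graph_Theory.Pair_Digraph"
begin

text \<open>
  Finite simple graphs are the \<^locale>\<open>pair_graph\<close>s of Graph\_Theory: finite, loop-free digraphs
  with a symmetric arc relation.
\<close>

subsection \<open>Disk graphs\<close>

definition delta_disk_graph :: "'a pair_pre_digraph \<Rightarrow> bool" where
  "delta_disk_graph G \<longleftrightarrow>
     pair_graph G \<and>
     (\<exists>(x :: 'a \<Rightarrow> real) (y :: 'a \<Rightarrow> real) (r :: 'a \<Rightarrow> real).
        (\<forall>v\<in>pverts G. 0 < x v \<and> 0 < y v \<and>
           max (x v) (y v) \<le> r v \<and> r v < sqrt ((x v)\<^sup>2 + (y v)\<^sup>2)) \<and>
        (\<forall>u\<in>pverts G. \<forall>v\<in>pverts G. u \<noteq> v \<longrightarrow>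
           ((u, v) \<in> parcs G \<longleftrightarrow> cball (x u, y u) (r u) \<inter> cball (x v, y v) (r v) \<noteq> {})))"

subsection \<open>Subcolorings\<close>

definition induces_disjoint_cliques :: "'a pair_pre_digraph \<Rightarrow> 'a set \<Rightarrow> bool" where
  "induces_disjoint_cliques G S \<longleftrightarrow>
     (\<exists>\<C>. partition_on S \<C> \<and>
        (\<forall>u\<in>S. \<forall>v\<in>S. u \<noteq> v \<longrightarrow> ((u, v) \<in> parcs G \<longleftrightarrow> (\<exists>C\<in>\<C>. u \<in> C \<and> v \<in> C))))"

lemma induces_disjoint_cliques_iff_no_induced_P3:
  assumes "pair_graph G"
  shows "induces_disjoint_cliques G S \<longleftrightarrow>
    \<not> (\<exists>u\<in>S. \<exists>v\<in>S. \<exists>w\<in>S. u \<noteq> w \<and> (u, v) \<in> parcs G \<and> (v, w) \<in> parcs G \<and> (u, w) \<notin> parcs G)"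
    (is "_ \<longleftrightarrow> \<not> ?P3")
proof -
  have symG: "(b, a) \<in> parcs G" if "(a, b) \<in> parcs G" for a b
    using that pair_sym_digraph.arcs_symmetric assms by (metis pair_graph.axioms(2) pair_pseudo_graph.axioms(2))
  have loop: "(a, a) \<notin> parcs G" for a
    using assms pair_loopfree_digraph.pair_no_loops[of G "(a, a)"]
    by (metis fst_conv snd_conv pair_graph.axioms(1) pair_digraph.axioms(2))
  show ?thesis
  proof (rule iffI)
    assume "induces_disjoint_cliques G S"
    then obtain \<C> where P: "partition_on S \<C>"
      and A: "\<forall>u\<in>S. \<forall>v\<in>S. u \<noteq> v \<longrightarrow>
                ((u, v) \<in> parcs G \<longleftrightarrow> (\<exists>C\<in>\<C>. u \<in> C \<and> v \<in> C))"
      unfolding induces_disjoint_cliques_def by (elim exE conjE)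
    show "\<not> ?P3"
    proof (rule notI)
      assume ?P3
      then obtain u v w where S: "u \<in> S" "v \<in> S" "w \<in> S" and uw: "u \<noteq> w"
        and e: "(u, v) \<in> parcs G" "(v, w) \<in> parcs G" and ne: "(u, w) \<notin> parcs G"
        by blast
      have "u \<noteq> v" "v \<noteq> w" using e loop by metis+
      then obtain C D where "C \<in> \<C>" "u \<in> C" "v \<in> C" "D \<in> \<C>" "v \<in> D" "w \<in> D"
        using A[rule_format, of u v] A[rule_format, of v w] S e by metis
      moreover from this have "C = D"
        using partition_onD2[OF P] by (metis IntI disjointD empty_iff)
      ultimately show False using A[rule_format, of u w] S uw ne by metis
    qed
  next
    assume no: "\<not> ?P3"
    define R where "R = {(u, v). u \<in> S \<and> v \<in> S \<and> (u = v \<or> (u, v) \<in> parcs G)}"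
    have "trans R"
      unfolding R_def using no by (intro transI) blast
    then have eq: "equiv S R"
      by (intro equivI) (auto simp: R_def refl_on_def sym_def intro: symG)
    have "(u, v) \<in> parcs G \<longleftrightarrow> (\<exists>C\<in>S // R. u \<in> C \<and> v \<in> C)"
      if "u \<in> S" "v \<in> S" "u \<noteq> v" for u v
    proof -
      have "(\<exists>C\<in>S // R. u \<in> C \<and> v \<in> C) \<longleftrightarrow> (u, v) \<in> R"
      proof
        assume "\<exists>C\<in>S // R. u \<in> C \<and> v \<in> C"
        then show "(u, v) \<in> R" using in_quotient_imp_in_rel[OF eq] by blast
      next
        assume "(u, v) \<in> R"
        then have "u \<in> R `` {u}" "v \<in> R `` {u}" using equiv_class_self[OF eq] that by auto
        then show "\<exists>C\<in>S // R. u \<in> C \<and> v \<in> C" using quotientI[OF that(1)] by blast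
      qed
      then show ?thesis using that by (simp add: R_def)
    qed
    then show "induces_disjoint_cliques G S"
      unfolding induces_disjoint_cliques_def
      using partition_on_quotient[OF eq] by blast
  qed
qed

definition subcoloring :: "'a pair_pre_digraph \<Rightarrow> 'a set set \<Rightarrow> bool" where
  "subcoloring G \<P> \<longleftrightarrow>
     partition_on (pverts G) \<P> \<and> (\<forall>S\<in>\<P>. induces_disjoint_cliques G S)"

definition subchromatic_number :: "'a pair_pre_digraph \<Rightarrow> nat" where
  "subchromatic_number G = (LEAST k. \<exists>\<P>. subcoloring G \<P> \<and> card \<P> = k)"

definition color_classes :: "'a set \<Rightarrow> ('a \<Rightarrow> 'c) \<Rightarrow> 'a set set" where
  "color_classes V f = (\<lambda>v. {w \<in> V. f w = f v}) ` V"

lemma partition_on_color_classes: "partition_on V (color_classes V f)"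
  unfolding color_classes_def
  by (rule partition_onI) (auto simp: disjnt_def)

lemma subcoloring_singletons: "subcoloring G (color_classes (pverts G) id)"
proof -
  have "induces_disjoint_cliques G {v}" for v
    unfolding induces_disjoint_cliques_def
    by (rule exI[of _ "{{v}}"]) (auto simp: partition_on_def)
  moreover have "S \<in> color_classes (pverts G) id \<Longrightarrow> \<exists>v. S = {v}" for S
    by (auto simp: color_classes_def)
  ultimately show ?thesis
    unfolding subcoloring_def using partition_on_color_classes by metis
qed

subsection \<open>Polynomial time\<close>

text \<open>
  The model of computation is the random access machine with addition and truncated subtraction,
  at unit cost, with structured control flow. Its memory consists of named arrays of natural
  numbers; a scalar variable is cell 0 of an array. A program mentions only finitely many arrays,
  so these can be interleaved in one memory, and its expressions have bounded size, so charging one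
  step per command executed or test evaluated is the usual uniform cost up to a constant factor.
  There is no unit-cost multiplication: each step adds only a constant number of bits to the largest
  number in memory, so that polynomial time here is polynomial time on Turing machines
  (Cook and Reckhow 1973).
\<close>

type_synonym memory = "string \<Rightarrow> nat \<Rightarrow> nat"

datatype expr =
    Const nat
  | Cell string expr
  | Plus expr expr
  | Minus expr expr

fun val :: "expr \<Rightarrow> memory \<Rightarrow> nat" where
  "val (Const k) m = k"
| "val (Cell a e) m = m a (val e m)"
| "val (Plus e e') m = val e m + val e' m"
| "val (Minus e e') m = val e m - val e' m"

datatype prog =
    Skip
  | Store string expr expr
  | Seq prog prog
  | Cond expr prog prog
  | While expr prog

text \<open>Store a i e assigns the value of e to cell i of the array a. Tests succeed on nonzero values.\<close>

inductive exec :: "prog \<Rightarrow> memory \<Rightarrow> nat \<Rightarrow> memory \<Rightarrow> bool" where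
  Skip: "exec Skip m 1 m"
| Store: "exec (Store a i e) m 1 (m(a := (m a)(val i m := val e m)))"
| Seq: "exec p m t m' \<Longrightarrow> exec q m' t' m'' \<Longrightarrow> exec (Seq p q) m (t + t') m''"
| CondTrue: "val e m \<noteq> 0 \<Longrightarrow> exec p m t m' \<Longrightarrow> exec (Cond e p q) m (Suc t) m'"
| CondFalse: "val e m = 0 \<Longrightarrow> exec q m t m' \<Longrightarrow> exec (Cond e p q) m (Suc t) m'"
| WhileFalse: "val e m = 0 \<Longrightarrow> exec (While e p) m 1 m"
| WhileTrue: "val e m \<noteq> 0 \<Longrightarrow> exec p m t m' \<Longrightarrow> exec (While e p) m' t' m'' \<Longrightarrow>
    exec (While e p) m (Suc (t + t')) m''"

inductive_cases SkipE: "exec Skip m t m'"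
inductive_cases StoreE: "exec (Store a i e) m t m'"
inductive_cases SeqE: "exec (Seq p q) m t m'"
inductive_cases CondE: "exec (Cond e p q) m t m'"
inductive_cases WhileE: "exec (While e p) m t m'"

lemma exec_deterministic:
  "exec p m t m' \<Longrightarrow> exec p m u m'' \<Longrightarrow> t = u \<and> m' = m''"
proof (induction arbitrary: u m'' rule: exec.induct)
  case (Seq p m t m1 q t' m2)
  from Seq.prems obtain v n v' where "u = v + v'" "exec p m v n" "exec q n v' m''"
    by (rule SeqE)
  with Seq.IH show ?case by blast
next
  case (WhileTrue e m p t m1 t' m2)
  from WhileTrue.prems WhileTrue.hyps(1) obtain v n v'
    where "u = Suc (v + v')" "exec p m v n" "exec (While e p) n v' m''"
    by - (erule WhileE, simp_all)
  with WhileTrue.IH show ?case by blast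
next
  case (CondTrue e m p t m1 q)
  from CondTrue.prems CondTrue.hyps(1) obtain v where "u = Suc v" "exec p m v m''"
    by (auto elim: CondE)
  with CondTrue.IH show ?case by blast
next
  case (CondFalse e m q t m1 p)
  from CondFalse.prems CondFalse.hyps(1) obtain v where "u = Suc v" "exec q m v m''"
    by (auto elim: CondE)
  with CondFalse.IH show ?case by blast
next
  case (WhileFalse e m p)
  from WhileFalse.prems show ?case
    by (rule WhileE) (use WhileFalse.hyps in simp_all)
qed (auto elim: SkipE StoreE)

text \<open>
  On every instance in I, program p halts within time polynomial in the size of the instance, in a
  memory that is a correct output for it.
\<close>

definition solves_in_poly_time ::
  "prog \<Rightarrow> 'i set \<Rightarrow> ('i \<Rightarrow> nat) \<Rightarrow> ('i \<Rightarrow> memory) \<Rightarrow> ('i \<Rightarrow> memory \<Rightarrow> bool) \<Rightarrow> bool" where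
  "solves_in_poly_time p I size_of input correct \<longleftrightarrow>
     (\<exists>b :: nat poly. \<forall>x\<in>I. \<exists>t m. exec p (input x) t m \<and> t \<le> poly b (size_of x) \<and> correct x m)"

text \<open>
  A graph on the vertices 0, ..., n - 1 is input as n together with its adjacency matrix, stored
  row by row. The number of vertices serves as the size of the instance, being polynomially related
  to the length of this input.
\<close>

definition order_of :: "nat pair_pre_digraph \<Rightarrow> nat" where
  "order_of G = card (pverts G)"

definition graph_input :: "nat pair_pre_digraph \<Rightarrow> memory" where
  "graph_input G = (\<lambda>a k.
     if a = ''n'' \<and> k = 0 then order_of G
     else if a = ''adj'' \<and> k < order_of G * order_of G \<and>
             (k div order_of G, k mod order_of G) \<in> parcs G then 1
     else 0)"

text \<open>Cell v of the array col holds the color of vertex v.\<close>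

definition output_partition :: "nat pair_pre_digraph \<Rightarrow> memory \<Rightarrow> nat set set" where
  "output_partition G m = color_classes (pverts G) (m ''col'')"

end

theory Submission
  imports Defs
begin

text \<open>
  In polar coordinates with logarithmic radius, a disk of the representation looks like an interval
  up to a bounded error: if \<open>[lo v, hi v]\<close> is the logarithm of its trace on the diagonal, then
  intersecting intervals give adjacent vertices, adjacent vertices have intervals at distance at most
  \<open>ln 2\<close>, and all intervals are longer than \<open>2 * ln 2\<close>.

  Repeatedly discard the vertices that have no seven pairwise nonadjacent neighbors left. If a vertex
  survives \<open>k\<close> rounds, then the vertices whose intervals lie inside its own need more than \<open>k\<close>
  colors, so at most \<open>\<chi>\<^sub>s\<close> rounds are needed. The vertices discarded in the same round are then
  colored with boundedly many colors. Take an independent set \<open>S\<close> that is optimal under replacing one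
  vertex by two, and group the vertices by their first and last neighbor in \<open>S\<close>. A group with one such
  neighbor is a clique by optimality; in a group with two, no three vertices are pairwise nonadjacent,
  as they would all have to cross the narrow gap between these two neighbors, and so nonadjacency is
  bipartite there. Groups that touch are told apart by a greedy coloring of \<open>S\<close> in which vertices at
  distance at most 3 have different colors; each vertex of \<open>S\<close> has at most 26 others that close.

  Everything is expressed in a language of loops over \<open>{..<n}\<close> with tests by formulas whose quantifiers
  are bounded by \<open>n\<close>; such programs run in polynomial time.
\<close>

subsection \<open>Loop programs\<close>

text \<open>The representation is not part of the input, so \<open>lo\<close> and \<open>hi\<close>
  occur in proofs only; every test of the algorithm speaks of adjacency and of vertex numbers. This
  is why colors come from local search, first fit and propagated parities and not from a scan along
  the line. The obstacle is that adjacent vertices may have disjoint intervals. The length condition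
  makes up for it: an edge bridges a gap of at most \<open>e\<close> (here \<open>ln 2\<close>), so
  it cannot jump over an interval, all intervals being longer than \<open>2 * e\<close>. This also
  gives the constants. Among pairwise nonadjacent neighbors of a vertex at most two protrude from
  its interval on either side; with seven of them three lie inside, and the middle one of these
  keeps the outer two apart. Without such a star, a vertex touches at most 6 members of
  \<open>S\<close>, and a walk of length 3 to one side meets at most \<open>1 + 6 + 6 = 13\<close>
  of them.\<close>

datatype tm = Lit nat | Var nat | Arr string tm | Add tm tm | Sub tm tm

datatype fm = Less tm tm | Equal tm tm | Neg fm | Conj fm fm | Exists fm

datatype loop = Assign string tm tm | Then loop loop | When fm loop | For loop

text \<open>Variables are de Bruijn levels: values are appended to \<open>env\<close>, so
  \<open>Var 0\<close> belongs to the outermost binder. A variable keeps its number under further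
  binders and can therefore live in a fixed memory cell.\<close>

primrec tval :: "tm \<Rightarrow> nat list \<Rightarrow> memory \<Rightarrow> nat" where
  "tval (Lit k) env m = k"
| "tval (Var j) env m = env ! j"
| "tval (Arr a t) env m = m a (tval t env m)"
| "tval (Add s t) env m = tval s env m + tval t env m"
| "tval (Sub s t) env m = tval s env m - tval t env m"

primrec sat :: "fm \<Rightarrow> nat list \<Rightarrow> memory \<Rightarrow> bool" where
  "sat (Less s t) env m \<longleftrightarrow> tval s env m < tval t env m"
| "sat (Equal s t) env m \<longleftrightarrow> tval s env m = tval t env m"
| "sat (Neg \<phi>) env m \<longleftrightarrow> \<not> sat \<phi> env m"
| "sat (Conj \<phi> \<psi>) env m \<longleftrightarrow> sat \<phi> env m \<and> sat \<psi> env m"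
| "sat (Exists \<phi>) env m \<longleftrightarrow> (\<exists>i < m ''n'' 0. sat \<phi> (env @ [i]) m)"

primrec run :: "loop \<Rightarrow> nat list \<Rightarrow> memory \<Rightarrow> memory" where
  "run (Assign a s t) env m = m(a := (m a)(tval s env m := tval t env m))"
| "run (Then p q) env m = run q env (run p env m)"
| "run (When \<phi> p) env m = (if sat \<phi> env m then run p env m else m)"
| "run (For p) env m = fold (\<lambda>i. run p (env @ [i])) [0..<m ''n'' 0] m"

primrec wf_tm :: "nat \<Rightarrow> tm \<Rightarrow> bool" where
  "wf_tm k (Lit c) \<longleftrightarrow> True"
| "wf_tm k (Var j) \<longleftrightarrow> j < k"
| "wf_tm k (Arr a t) \<longleftrightarrow> a \<noteq> ''_'' \<and> wf_tm k t"
| "wf_tm k (Add s t) \<longleftrightarrow> wf_tm k s \<and> wf_tm k t"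
| "wf_tm k (Sub s t) \<longleftrightarrow> wf_tm k s \<and> wf_tm k t"

primrec wf_fm :: "nat \<Rightarrow> fm \<Rightarrow> bool" where
  "wf_fm k (Less s t) \<longleftrightarrow> wf_tm k s \<and> wf_tm k t"
| "wf_fm k (Equal s t) \<longleftrightarrow> wf_tm k s \<and> wf_tm k t"
| "wf_fm k (Neg \<phi>) \<longleftrightarrow> wf_fm k \<phi>"
| "wf_fm k (Conj \<phi> \<psi>) \<longleftrightarrow> wf_fm k \<phi> \<and> wf_fm k \<psi>"
| "wf_fm k (Exists \<phi>) \<longleftrightarrow> wf_fm (Suc k) \<phi>"

text \<open>The array \<open>_\<close> is reserved for the compiler. Excluding assignments to
  \<open>n\<close> as well fixes the range of all loops and quantifiers for the whole run.\<close>

primrec wf_loop :: "nat \<Rightarrow> loop \<Rightarrow> bool" where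
  "wf_loop k (Assign a s t) \<longleftrightarrow> a \<noteq> ''_'' \<and> a \<noteq> ''n'' \<and> wf_tm k s \<and> wf_tm k t"
| "wf_loop k (Then p q) \<longleftrightarrow> wf_loop k p \<and> wf_loop k q"
| "wf_loop k (When \<phi> p) \<longleftrightarrow> wf_fm k \<phi> \<and> wf_loop k p"
| "wf_loop k (For p) \<longleftrightarrow> wf_loop (Suc k) p"

text \<open>The compiled program keeps the loop variable of level \<open>k\<close> in cell \<open>2 * k\<close> of the array \<open>_\<close>, and
  the truth value of a formula evaluated at level \<open>k\<close> in cell \<open>2 * k + 1\<close>.\<close>

abbreviation scratch :: "nat \<Rightarrow> expr" where
  "scratch c \<equiv> Cell ''_'' (Const c)"

abbreviation set_scratch :: "nat \<Rightarrow> expr \<Rightarrow> prog" where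
  "set_scratch c e \<equiv> Store ''_'' (Const c) e"

primrec compile_tm :: "tm \<Rightarrow> expr" where
  "compile_tm (Lit c) = Const c"
| "compile_tm (Var j) = scratch (2 * j)"
| "compile_tm (Arr a t) = Cell a (compile_tm t)"
| "compile_tm (Add s t) = Plus (compile_tm s) (compile_tm t)"
| "compile_tm (Sub s t) = Minus (compile_tm s) (compile_tm t)"

definition for_loop :: "nat \<Rightarrow> prog \<Rightarrow> prog" where
  "for_loop k p = Seq (set_scratch (2 * k) (Const 0))
     (While (Minus (Cell ''n'' (Const 0)) (scratch (2 * k)))
       (Seq p (set_scratch (2 * k) (Plus (scratch (2 * k)) (Const 1)))))"

text \<open>Truncated subtraction replaces comparison: \<open>t - s\<close> is nonzero exactly if
  \<open>s < t\<close>, and \<open>1 - ((s - t) + (t - s))\<close> exactly if \<open>s = t\<close>.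
  The parts of a conjunction share a cell: a failing first part has already left the right value 0
  there, otherwise the second part overwrites it. The body of \<open>Exists\<close> is evaluated one
  level deeper, so its truth value does not interfere with the flag that collects the
  results.\<close>

primrec compile_fm :: "nat \<Rightarrow> fm \<Rightarrow> prog" where
  "compile_fm k (Less s t) = set_scratch (2 * k + 1) (Minus (compile_tm t) (compile_tm s))"
| "compile_fm k (Equal s t) = set_scratch (2 * k + 1)
     (Minus (Const 1) (Plus (Minus (compile_tm s) (compile_tm t)) (Minus (compile_tm t) (compile_tm s))))"
| "compile_fm k (Neg \<phi>) =
     Seq (compile_fm k \<phi>) (set_scratch (2 * k + 1) (Minus (Const 1) (scratch (2 * k + 1))))"
| "compile_fm k (Conj \<phi> \<psi>) =
     Seq (compile_fm k \<phi>) (Cond (scratch (2 * k + 1)) (compile_fm k \<psi>) Skip)"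
| "compile_fm k (Exists \<phi>) = Seq (set_scratch (2 * k + 1) (Const 0))
     (for_loop k (Seq (compile_fm (Suc k) \<phi>)
       (Cond (scratch (2 * Suc k + 1)) (set_scratch (2 * k + 1) (Const 1)) Skip)))"

primrec compile :: "nat \<Rightarrow> loop \<Rightarrow> prog" where
  "compile k (Assign a s t) = Store a (compile_tm s) (compile_tm t)"
| "compile k (Then p q) = Seq (compile k p) (compile k q)"
| "compile k (When \<phi> p) = Seq (compile_fm k \<phi>) (Cond (scratch (2 * k + 1)) (compile k p) Skip)"
| "compile k (For p) = for_loop k (compile (Suc k) p)"

section \<open>Correctness and running time of compiled programs\<close>

definition represents :: "memory \<Rightarrow> nat list \<Rightarrow> memory \<Rightarrow> bool" where
  "represents \<mu> env m \<longleftrightarrow>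
     (\<forall>a. a \<noteq> ''_'' \<longrightarrow> \<mu> a = m a) \<and> (\<forall>j < length env. \<mu> ''_'' (2 * j) = env ! j)"

text \<open>The cells below \<open>2 * k\<close> hold the variables and truth values of the
  enclosing levels. Code of level \<open>k\<close> has to preserve them all, in particular the flag
  of an enclosing \<open>Exists\<close>, of which \<open>represents\<close> does not speak.\<close>

definition agree_below :: "nat \<Rightarrow> memory \<Rightarrow> memory \<Rightarrow> bool" where
  "agree_below k \<mu> \<mu>' \<longleftrightarrow> (\<forall>c < 2 * k. \<mu>' ''_'' c = \<mu> ''_'' c)"

lemma agree_below_refl: "agree_below k \<mu> \<mu>"
  by (simp add: agree_below_def)

lemma agree_below_trans: "agree_below k \<mu> \<mu>' \<Longrightarrow> agree_below k \<mu>' \<mu>'' \<Longrightarrow> agree_below k \<mu> \<mu>''"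
  by (simp add: agree_below_def)

lemma agree_below_set_scratch:
  "agree_below k \<mu> (\<mu>(''_'' := (\<mu> ''_'')(c := x)))" if "2 * k \<le> c"
  using that by (simp add: agree_below_def)

lemma represents_set_scratch:
  "represents \<mu> env m \<Longrightarrow> 2 * length env \<le> c \<Longrightarrow>
    represents (\<mu>(''_'' := (\<mu> ''_'')(c := x))) env m"
  by (auto simp: represents_def)

lemma represents_n: "represents \<mu> env m \<Longrightarrow> \<mu> ''n'' 0 = m ''n'' 0"
  by (simp add: represents_def)

lemma represents_append:
  "represents \<mu> env m \<Longrightarrow> \<mu> ''_'' (2 * length env) = i \<Longrightarrow> represents \<mu> (env @ [i]) m"
  by (auto simp: represents_def nth_append less_Suc_eq)

lemma represents_butlast: "represents \<mu> (env @ [i]) m \<Longrightarrow> represents \<mu> env m"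
  unfolding represents_def by (simp add: nth_append)

lemma val_compile_tm:
  "wf_tm (length env) t \<Longrightarrow> represents \<mu> env m \<Longrightarrow> val (compile_tm t) \<mu> = tval t env m"
  by (induction t) (auto simp: represents_def)

text \<open>The increment changes the counter cell after the body has established the invariant,
  hence the assumption that \<open>I\<close> ignores that cell. An iteration costs \<open>B\<close>
  for the body and 2 for test and increment; initialization and the failing last test cost 2
  more.\<close>

lemma exec_for_loop:
  assumes body: "\<And>i \<mu>. i < N \<Longrightarrow> I i \<mu> \<Longrightarrow> \<mu> ''n'' 0 = N \<Longrightarrow> \<mu> ''_'' (2 * k) = i \<Longrightarrow>
      \<exists>t \<mu>'. exec p \<mu> t \<mu>' \<and> t \<le> B \<and> I (Suc i) \<mu>' \<and> \<mu>' ''n'' 0 = N \<and> \<mu>' ''_'' (2 * k) = i"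
    and counter: "\<And>i \<mu> x. I i \<mu> \<Longrightarrow> I i (\<mu>(''_'' := (\<mu> ''_'')(2 * k := x)))"
    and start: "I 0 \<mu>" "\<mu> ''n'' 0 = N"
  shows "\<exists>t \<mu>'. exec (for_loop k p) \<mu> t \<mu>' \<and> t \<le> 2 + N * (B + 2) \<and> I N \<mu>'"
proof -
  let ?inc = "set_scratch (2 * k) (Plus (scratch (2 * k)) (Const 1))"
  let ?W = "While (Minus (Cell ''n'' (Const 0)) (scratch (2 * k))) (Seq p ?inc)"
  have loop: "\<exists>t \<mu>'. exec ?W \<mu> t \<mu>' \<and> t \<le> 1 + d * (B + 2) \<and> I N \<mu>'"
    if "d = N - i" "i \<le> N" "I i \<mu>" "\<mu> ''n'' 0 = N" "\<mu> ''_'' (2 * k) = i" for d i \<mu>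
    using that
  proof (induction d arbitrary: i \<mu>)
    case 0
    then have "exec ?W \<mu> 1 \<mu>" by (intro exec.WhileFalse) simp
    then show ?case using 0 by (intro exI[of _ 1] exI[of _ \<mu>]) simp
  next
    case (Suc d)
    then have "i < N" by simp
    then obtain t \<mu>1 where 1: "exec p \<mu> t \<mu>1" "t \<le> B" "I (Suc i) \<mu>1" "\<mu>1 ''n'' 0 = N"
        "\<mu>1 ''_'' (2 * k) = i"
      using body Suc.prems by blast
    define \<mu>2 where "\<mu>2 = \<mu>1(''_'' := (\<mu>1 ''_'')(2 * k := Suc i))"
    have 2: "exec ?inc \<mu>1 1 \<mu>2"
      using exec.Store[of "''_''" "Const (2 * k)" "Plus (scratch (2 * k)) (Const 1)" \<mu>1] 1
      by (simp add: \<mu>2_def)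
    have "\<exists>t \<mu>'. exec ?W \<mu>2 t \<mu>' \<and> t \<le> 1 + d * (B + 2) \<and> I N \<mu>'"
      proof (rule Suc.IH[of "Suc i"])
      show "I (Suc i) \<mu>2" unfolding \<mu>2_def by (rule counter[OF 1(3)])
    qed (use Suc.prems \<open>i < N\<close> 1 in \<open>auto simp: \<mu>2_def\<close>)
    then obtain t' \<mu>' where 3: "exec ?W \<mu>2 t' \<mu>'" "t' \<le> 1 + d * (B + 2)" "I N \<mu>'" by blast
    have "exec ?W \<mu> (Suc ((t + 1) + t')) \<mu>'"
      using Suc.prems \<open>i < N\<close> by (intro exec.WhileTrue[OF _ exec.Seq[OF 1(1) 2] 3(1)]) simp
    then show ?case using 1(2) 3 by (intro exI conjI) auto
  qed
  define \<mu>0 where "\<mu>0 = \<mu>(''_'' := (\<mu> ''_'')(2 * k := 0))"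
  have 0: "exec (set_scratch (2 * k) (Const 0)) \<mu> 1 \<mu>0"
    using exec.Store[of "''_''" "Const (2 * k)" "Const 0" \<mu>] by (simp add: \<mu>0_def)
  obtain t \<mu>' where "exec ?W \<mu>0 t \<mu>'" "t \<le> 1 + N * (B + 2)" "I N \<mu>'"
    using loop[of N 0 \<mu>0] start counter by (auto simp: \<mu>0_def)
  then show ?thesis
    unfolding for_loop_def using exec.Seq[OF 0] by (intro exI conjI) auto
qed

lemma exec_set_scratch:
  "x = val e \<mu> \<Longrightarrow> exec (set_scratch c e) \<mu> 1 (\<mu>(''_'' := (\<mu> ''_'')(c := x)))"
  using exec.Store[of "''_''" "Const c" e \<mu>] by simp

text \<open>The polynomial is chosen before environment and memory, so one bound serves all
  iterations of a quantifier, which then costs essentially a factor \<open>n\<close>.\<close>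

lemma exec_compile_fm:
  "wf_fm k \<phi> \<Longrightarrow> \<exists>b. \<forall>env m \<mu>. length env = k \<longrightarrow> represents \<mu> env m \<longrightarrow>
     (\<exists>t \<mu>'. exec (compile_fm k \<phi>) \<mu> t \<mu>' \<and> t \<le> poly b (m ''n'' 0) \<and> represents \<mu>' env m \<and>
        agree_below k \<mu> \<mu>' \<and> (\<mu>' ''_'' (2 * k + 1) \<noteq> 0 \<longleftrightarrow> sat \<phi> env m))"
proof (induction \<phi> arbitrary: k)
  case (Less s t)
  show ?case
  proof (intro exI[of _ "[:1:]"] allI impI)
    fix env m \<mu> assume 1: "length env = k" "represents \<mu> env m"
    let ?x = "tval t env m - tval s env m"
    have "exec (compile_fm k (Less s t)) \<mu> 1 (\<mu>(''_'' := (\<mu> ''_'')(2 * k + 1 := ?x)))"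
      unfolding compile_fm.simps using Less 1 by (intro exec_set_scratch) (simp add: val_compile_tm[of env _ \<mu> m])
    then show "\<exists>ta \<mu>'. exec (compile_fm k (Less s t)) \<mu> ta \<mu>' \<and> ta \<le> poly [:1:] (m ''n'' 0) \<and>
        represents \<mu>' env m \<and> agree_below k \<mu> \<mu>' \<and>
        (\<mu>' ''_'' (2 * k + 1) \<noteq> 0 \<longleftrightarrow> sat (Less s t) env m)"
      using 1 by (intro exI conjI) (assumption, auto simp: represents_set_scratch agree_below_set_scratch)
  qed
next
  case (Equal s t)
  show ?case
  proof (intro exI[of _ "[:1:]"] allI impI)
    fix env m \<mu> assume 1: "length env = k" "represents \<mu> env m"
    let ?x = "1 - ((tval s env m - tval t env m) + (tval t env m - tval s env m))"
    have "exec (compile_fm k (Equal s t)) \<mu> 1 (\<mu>(''_'' := (\<mu> ''_'')(2 * k + 1 := ?x)))"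
      unfolding compile_fm.simps using Equal 1 by (intro exec_set_scratch) (simp add: val_compile_tm[of env _ \<mu> m])
    then show "\<exists>ta \<mu>'. exec (compile_fm k (Equal s t)) \<mu> ta \<mu>' \<and> ta \<le> poly [:1:] (m ''n'' 0) \<and>
        represents \<mu>' env m \<and> agree_below k \<mu> \<mu>' \<and>
        (\<mu>' ''_'' (2 * k + 1) \<noteq> 0 \<longleftrightarrow> sat (Equal s t) env m)"
      using 1 by (intro exI conjI) (assumption, auto simp: represents_set_scratch agree_below_set_scratch)
  qed
next
  case (Neg \<phi>)
  then obtain b where b: "\<And>env m \<mu>. length env = k \<Longrightarrow> represents \<mu> env m \<Longrightarrow>
     (\<exists>t \<mu>'. exec (compile_fm k \<phi>) \<mu> t \<mu>' \<and> t \<le> poly b (m ''n'' 0) \<and> represents \<mu>' env m \<and>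
        agree_below k \<mu> \<mu>' \<and> (\<mu>' ''_'' (2 * k + 1) \<noteq> 0 \<longleftrightarrow> sat \<phi> env m))"
    by fastforce
  show ?case
  proof (intro exI[of _ "b + [:1:]"] allI impI)
    fix env m \<mu> assume 1: "length env = k" "represents \<mu> env m"
    from b[OF 1] obtain t \<mu>1 where 2: "exec (compile_fm k \<phi>) \<mu> t \<mu>1" "t \<le> poly b (m ''n'' 0)"
        "represents \<mu>1 env m" "agree_below k \<mu> \<mu>1" "\<mu>1 ''_'' (2 * k + 1) \<noteq> 0 \<longleftrightarrow> sat \<phi> env m"
      by blast
    have "exec (compile_fm k (Neg \<phi>)) \<mu> (t + 1)
        (\<mu>1(''_'' := (\<mu>1 ''_'')(2 * k + 1 := 1 - \<mu>1 ''_'' (2 * k + 1))))"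
      unfolding compile_fm.simps by (intro exec.Seq[OF 2(1)] exec_set_scratch) simp
    then show "\<exists>t \<mu>'. exec (compile_fm k (Neg \<phi>)) \<mu> t \<mu>' \<and> t \<le> poly (b + [:1:]) (m ''n'' 0) \<and>
        represents \<mu>' env m \<and> agree_below k \<mu> \<mu>' \<and>
        (\<mu>' ''_'' (2 * k + 1) \<noteq> 0 \<longleftrightarrow> sat (Neg \<phi>) env m)"
      using 1 2 agree_below_trans[OF 2(4) agree_below_set_scratch]
      by (intro exI conjI) (assumption, auto simp: represents_set_scratch)
  qed
next
  case (Conj \<phi> \<psi>)
  then obtain b where b: "\<And>env m \<mu>. length env = k \<Longrightarrow> represents \<mu> env m \<Longrightarrow>
     (\<exists>t \<mu>'. exec (compile_fm k \<phi>) \<mu> t \<mu>' \<and> t \<le> poly b (m ''n'' 0) \<and> represents \<mu>' env m \<and>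
        agree_below k \<mu> \<mu>' \<and> (\<mu>' ''_'' (2 * k + 1) \<noteq> 0 \<longleftrightarrow> sat \<phi> env m))"
    by fastforce
  from Conj obtain c where c: "\<And>env m \<mu>. length env = k \<Longrightarrow> represents \<mu> env m \<Longrightarrow>
     (\<exists>t \<mu>'. exec (compile_fm k \<psi>) \<mu> t \<mu>' \<and> t \<le> poly c (m ''n'' 0) \<and> represents \<mu>' env m \<and>
        agree_below k \<mu> \<mu>' \<and> (\<mu>' ''_'' (2 * k + 1) \<noteq> 0 \<longleftrightarrow> sat \<psi> env m))"
    by fastforce
  show ?case
  proof (intro exI[of _ "b + c + [:2:]"] allI impI)
    fix env m \<mu> assume 1: "length env = k" "represents \<mu> env m"
    from b[OF 1] obtain t \<mu>1 where 2: "exec (compile_fm k \<phi>) \<mu> t \<mu>1" "t \<le> poly b (m ''n'' 0)"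
        "represents \<mu>1 env m" "agree_below k \<mu> \<mu>1" "\<mu>1 ''_'' (2 * k + 1) \<noteq> 0 \<longleftrightarrow> sat \<phi> env m"
      by blast
    from c[OF 1(1) 2(3)] obtain t' \<mu>2 where 3: "exec (compile_fm k \<psi>) \<mu>1 t' \<mu>2"
        "t' \<le> poly c (m ''n'' 0)" "represents \<mu>2 env m" "agree_below k \<mu>1 \<mu>2"
        "\<mu>2 ''_'' (2 * k + 1) \<noteq> 0 \<longleftrightarrow> sat \<psi> env m"
      by blast
    show "\<exists>t \<mu>'. exec (compile_fm k (Conj \<phi> \<psi>)) \<mu> t \<mu>' \<and> t \<le> poly (b + c + [:2:]) (m ''n'' 0) \<and>
        represents \<mu>' env m \<and> agree_below k \<mu> \<mu>' \<and>
        (\<mu>' ''_'' (2 * k + 1) \<noteq> 0 \<longleftrightarrow> sat (Conj \<phi> \<psi>) env m)"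
    proof (cases "sat \<phi> env m")
      case True
      then have "exec (compile_fm k (Conj \<phi> \<psi>)) \<mu> (t + Suc t') \<mu>2"
        unfolding compile_fm.simps using 2 3 by (intro exec.Seq[OF 2(1)] exec.CondTrue) auto
      then show ?thesis using 2 3 True agree_below_trans[OF 2(4) 3(4)]
        by (intro exI conjI) (assumption, auto)
    next
      case False
      then have "exec (compile_fm k (Conj \<phi> \<psi>)) \<mu> (t + Suc 1) \<mu>1"
        unfolding compile_fm.simps using 2
        by (intro exec.Seq[OF 2(1)] exec.CondFalse exec.Skip) auto
      then show ?thesis using 2 False by (intro exI conjI) (assumption, auto)
    qed
  qed
next
  case (Exists \<phi>)
  then obtain b where b: "\<And>env m \<mu>. length env = Suc k \<Longrightarrow> represents \<mu> env m \<Longrightarrow>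
     (\<exists>t \<mu>'. exec (compile_fm (Suc k) \<phi>) \<mu> t \<mu>' \<and> t \<le> poly b (m ''n'' 0) \<and> represents \<mu>' env m \<and>
        agree_below (Suc k) \<mu> \<mu>' \<and> (\<mu>' ''_'' (2 * Suc k + 1) \<noteq> 0 \<longleftrightarrow> sat \<phi> env m))"
    by fastforce
  let ?body = "Seq (compile_fm (Suc k) \<phi>)
       (Cond (scratch (2 * Suc k + 1)) (set_scratch (2 * k + 1) (Const 1)) Skip)"
  show ?case
  \<comment> \<open>\<open>[:0, 1:]\<close> is the monomial. Besides the formula, an iteration pays
    2 for the conditional raising the flag and 2 for the loop; the constant 3 is 1 for clearing the
    flag and 2 for entering and leaving the loop.\<close>
  proof (intro exI[of _ "[:3:] + [:0, 1:] * (b + [:4:])"] allI impI)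
    fix env m \<mu> assume 1: "length env = k" "represents \<mu> env m"
    let ?N = "m ''n'' 0"
    define I where "I = (\<lambda>i \<mu>'. represents \<mu>' env m \<and> agree_below k \<mu> \<mu>' \<and>
        (\<mu>' ''_'' (2 * k + 1) \<noteq> 0 \<longleftrightarrow> (\<exists>j<i. sat \<phi> (env @ [j]) m)))"
    define \<mu>0 where "\<mu>0 = \<mu>(''_'' := (\<mu> ''_'')(2 * k + 1 := 0))"
    have ex0: "exec (set_scratch (2 * k + 1) (Const 0)) \<mu> 1 \<mu>0"
      unfolding \<mu>0_def by (intro exec_set_scratch) simp
    have "\<exists>t \<mu>'. exec (for_loop k ?body) \<mu>0 t \<mu>' \<and> t \<le> 2 + ?N * ((poly b ?N + 2) + 2) \<and> I ?N \<mu>'"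
    proof (rule exec_for_loop)
      fix i \<nu> assume i: "i < ?N" "I i \<nu>" "\<nu> ''n'' 0 = ?N" "\<nu> ''_'' (2 * k) = i"
      then have "represents \<nu> (env @ [i]) m" using 1 by (intro represents_append) (auto simp: I_def)
      from b[OF _ this] 1 obtain t \<nu>1 where 2: "exec (compile_fm (Suc k) \<phi>) \<nu> t \<nu>1"
          "t \<le> poly b ?N" "represents \<nu>1 (env @ [i]) m" "agree_below (Suc k) \<nu> \<nu>1"
          "\<nu>1 ''_'' (2 * Suc k + 1) \<noteq> 0 \<longleftrightarrow> sat \<phi> (env @ [i]) m"
        by fastforce
      have same: "\<nu>1 ''_'' c = \<nu> ''_'' c" if "c < 2 * Suc k" for c
        using 2(4) that by (simp add: agree_below_def)
      have rep: "represents \<nu>1 env m" using 2(3) by (rule represents_butlast)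
      have below: "agree_below k \<mu> \<nu>1"
        using i(2) same by (simp add: I_def agree_below_def)
      show "\<exists>t \<mu>'. exec ?body \<nu> t \<mu>' \<and> t \<le> poly b ?N + 2 \<and> I (Suc i) \<mu>' \<and> \<mu>' ''n'' 0 = ?N \<and>
          \<mu>' ''_'' (2 * k) = i"
      proof (cases "sat \<phi> (env @ [i]) m")
        case True
        let ?\<nu>2 = "\<nu>1(''_'' := (\<nu>1 ''_'')(2 * k + 1 := 1))"
        have "exec ?body \<nu> (t + Suc 1) ?\<nu>2"
          using 2 True by (intro exec.Seq[OF 2(1)] exec.CondTrue exec_set_scratch) auto
        moreover have "I (Suc i) ?\<nu>2"
          using True 1 rep below agree_below_trans[OF below agree_below_set_scratch]
          by (auto simp: I_def represents_set_scratch)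
        ultimately show ?thesis using 2(2) rep i same by (intro exI conjI) (assumption, auto simp: represents_n)
      next
        case False
        have "exec ?body \<nu> (t + Suc 1) \<nu>1"
          using 2 False by (intro exec.Seq[OF 2(1)] exec.CondFalse exec.Skip) auto
        moreover have "I (Suc i) \<nu>1"
          using False rep below i(2) same by (auto simp: I_def less_Suc_eq)
        ultimately show ?thesis using 2(2) rep i same by (intro exI conjI) (assumption, auto simp: represents_n)
      qed
    next
      fix i \<nu> x assume "I i \<nu>"
      then show "I i (\<nu>(''_'' := (\<nu> ''_'')(2 * k := x)))"
        using 1 by (auto simp: I_def represents_set_scratch agree_below_def)
    next
      show "I 0 \<mu>0" using 1 by (auto simp: I_def \<mu>0_def represents_set_scratch agree_below_set_scratch)
      show "\<mu>0 ''n'' 0 = ?N" using 1 by (simp add: \<mu>0_def represents_n)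
    qed
    then obtain t \<mu>' where 3: "exec (for_loop k ?body) \<mu>0 t \<mu>'" "t \<le> 2 + ?N * ((poly b ?N + 2) + 2)"
        "I ?N \<mu>'" by blast
    have "exec (compile_fm k (Exists \<phi>)) \<mu> (1 + t) \<mu>'"
      unfolding compile_fm.simps by (rule exec.Seq[OF ex0 3(1)])
    then show "\<exists>t \<mu>'. exec (compile_fm k (Exists \<phi>)) \<mu> t \<mu>' \<and>
        t \<le> poly ([:3:] + [:0, 1:] * (b + [:4:])) (m ''n'' 0) \<and>
        represents \<mu>' env m \<and> agree_below k \<mu> \<mu>' \<and>
        (\<mu>' ''_'' (2 * k + 1) \<noteq> 0 \<longleftrightarrow> sat (Exists \<phi>) env m)"
      using 3 by (intro exI conjI) (assumption, auto simp: I_def algebra_simps)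
  qed
qed

lemma run_n: "wf_loop k p \<Longrightarrow> run p env m ''n'' = m ''n''"
proof (induction p arbitrary: k env m)
  case (For p)
  have "fold (\<lambda>i. run p (env @ [i])) xs m ''n'' = m ''n''" for xs
    by (induction xs arbitrary: m) (use For in auto)
  then show ?case by simp
qed auto

lemma exec_compile:
  "wf_loop k p \<Longrightarrow> \<exists>b. \<forall>env m \<mu>. length env = k \<longrightarrow> represents \<mu> env m \<longrightarrow>
     (\<exists>t \<mu>'. exec (compile k p) \<mu> t \<mu>' \<and> t \<le> poly b (m ''n'' 0) \<and>
        represents \<mu>' env (run p env m) \<and> agree_below k \<mu> \<mu>')"
proof (induction p arbitrary: k)
  case (Assign a s t)
  show ?case
  proof (intro exI[of _ "[:1:]"] allI impI)
    fix env m \<mu> assume 1: "length env = k" "represents \<mu> env m"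
    have "exec (compile k (Assign a s t)) \<mu> 1 (\<mu>(a := (\<mu> a)(tval s env m := tval t env m)))"
      unfolding compile.simps using exec.Store[of a "compile_tm s" "compile_tm t" \<mu>] Assign 1
      by (simp add: val_compile_tm[of env _ \<mu> m])
    then show "\<exists>ta \<mu>'. exec (compile k (Assign a s t)) \<mu> ta \<mu>' \<and> ta \<le> poly [:1:] (m ''n'' 0) \<and>
        represents \<mu>' env (run (Assign a s t) env m) \<and> agree_below k \<mu> \<mu>'"
      using 1 Assign by (intro exI conjI) (assumption, auto simp: represents_def agree_below_def)
  qed
next
  case (Then p q)
  then obtain b where b: "\<And>env m \<mu>. length env = k \<Longrightarrow> represents \<mu> env m \<Longrightarrow>
     (\<exists>t \<mu>'. exec (compile k p) \<mu> t \<mu>' \<and> t \<le> poly b (m ''n'' 0) \<and>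
        represents \<mu>' env (run p env m) \<and> agree_below k \<mu> \<mu>')"
    by fastforce
  from Then obtain c where c: "\<And>env m \<mu>. length env = k \<Longrightarrow> represents \<mu> env m \<Longrightarrow>
     (\<exists>t \<mu>'. exec (compile k q) \<mu> t \<mu>' \<and> t \<le> poly c (m ''n'' 0) \<and>
        represents \<mu>' env (run q env m) \<and> agree_below k \<mu> \<mu>')"
    by fastforce
  show ?case
  proof (intro exI[of _ "b + c"] allI impI)
    fix env m \<mu> assume 1: "length env = k" "represents \<mu> env m"
    from b[OF 1] obtain t \<mu>1 where 2: "exec (compile k p) \<mu> t \<mu>1" "t \<le> poly b (m ''n'' 0)"
        "represents \<mu>1 env (run p env m)" "agree_below k \<mu> \<mu>1" by blast
    from c[OF 1(1) 2(3)] Then.prems obtain t' \<mu>2 where 3: "exec (compile k q) \<mu>1 t' \<mu>2"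
        "t' \<le> poly c (m ''n'' 0)" "represents \<mu>2 env (run q env (run p env m))" "agree_below k \<mu>1 \<mu>2"
      using run_n[of k p env m] by auto
    show "\<exists>t \<mu>'. exec (compile k (Then p q)) \<mu> t \<mu>' \<and> t \<le> poly (b + c) (m ''n'' 0) \<and>
        represents \<mu>' env (run (Then p q) env m) \<and> agree_below k \<mu> \<mu>'"
      using exec.Seq[OF 2(1) 3(1)] 2 3 agree_below_trans[OF 2(4) 3(4)]
      by (intro exI[of _ "t + t'"] exI[of _ \<mu>2]) auto
  qed
next
  case (When \<phi> p)
  then obtain b where b: "\<And>env m \<mu>. length env = k \<Longrightarrow> represents \<mu> env m \<Longrightarrow>
     (\<exists>t \<mu>'. exec (compile_fm k \<phi>) \<mu> t \<mu>' \<and> t \<le> poly b (m ''n'' 0) \<and> represents \<mu>' env m \<and>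
        agree_below k \<mu> \<mu>' \<and> (\<mu>' ''_'' (2 * k + 1) \<noteq> 0 \<longleftrightarrow> sat \<phi> env m))"
    using exec_compile_fm[of k \<phi>] by fastforce
  from When obtain c where c: "\<And>env m \<mu>. length env = k \<Longrightarrow> represents \<mu> env m \<Longrightarrow>
     (\<exists>t \<mu>'. exec (compile k p) \<mu> t \<mu>' \<and> t \<le> poly c (m ''n'' 0) \<and>
        represents \<mu>' env (run p env m) \<and> agree_below k \<mu> \<mu>')"
    by fastforce
  show ?case
  proof (intro exI[of _ "b + c + [:2:]"] allI impI)
    fix env m \<mu> assume 1: "length env = k" "represents \<mu> env m"
    from b[OF 1] obtain t \<mu>1 where 2: "exec (compile_fm k \<phi>) \<mu> t \<mu>1" "t \<le> poly b (m ''n'' 0)"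
        "represents \<mu>1 env m" "agree_below k \<mu> \<mu>1" "\<mu>1 ''_'' (2 * k + 1) \<noteq> 0 \<longleftrightarrow> sat \<phi> env m"
      by blast
    from c[OF 1(1) 2(3)] obtain t' \<mu>2 where 3: "exec (compile k p) \<mu>1 t' \<mu>2"
        "t' \<le> poly c (m ''n'' 0)" "represents \<mu>2 env (run p env m)" "agree_below k \<mu>1 \<mu>2"
      by blast
    show "\<exists>t \<mu>'. exec (compile k (When \<phi> p)) \<mu> t \<mu>' \<and> t \<le> poly (b + c + [:2:]) (m ''n'' 0) \<and>
        represents \<mu>' env (run (When \<phi> p) env m) \<and> agree_below k \<mu> \<mu>'"
    proof (cases "sat \<phi> env m")
      case True
      then have "exec (compile k (When \<phi> p)) \<mu> (t + Suc t') \<mu>2"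
        unfolding compile.simps using 2 3 by (intro exec.Seq[OF 2(1)] exec.CondTrue) auto
      then show ?thesis using 2 3 True agree_below_trans[OF 2(4) 3(4)]
        by (intro exI conjI) (assumption, auto)
    next
      case False
      then have "exec (compile k (When \<phi> p)) \<mu> (t + Suc 1) \<mu>1"
        unfolding compile.simps using 2
        by (intro exec.Seq[OF 2(1)] exec.CondFalse exec.Skip) auto
      then show ?thesis using 2 False by (intro exI conjI) (assumption, auto)
    qed
  qed
next
  case (For p)
  then obtain b where b: "\<And>env m \<mu>. length env = Suc k \<Longrightarrow> represents \<mu> env m \<Longrightarrow>
     (\<exists>t \<mu>'. exec (compile (Suc k) p) \<mu> t \<mu>' \<and> t \<le> poly b (m ''n'' 0) \<and>
        represents \<mu>' env (run p env m) \<and> agree_below (Suc k) \<mu> \<mu>')"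
    by fastforce
  show ?case
  proof (intro exI[of _ "[:2:] + [:0, 1:] * (b + [:2:])"] allI impI)
    fix env m \<mu> assume 1: "length env = k" "represents \<mu> env m"
    let ?N = "m ''n'' 0"
    define st where "st = (\<lambda>i. fold (\<lambda>i. run p (env @ [i])) [0..<i] m)"
    have st_n: "st i ''n'' = m ''n''" for i
      using For.prems run_n[of "Suc k" p] by (induction i) (auto simp: st_def)
    define I where "I = (\<lambda>i \<mu>'. represents \<mu>' env (st i) \<and> agree_below k \<mu> \<mu>')"
    have "\<exists>t \<mu>'. exec (for_loop k (compile (Suc k) p)) \<mu> t \<mu>' \<and> t \<le> 2 + ?N * (poly b ?N + 2) \<and> I ?N \<mu>'"
    proof (rule exec_for_loop)
      fix i \<nu> assume i: "i < ?N" "I i \<nu>" "\<nu> ''n'' 0 = ?N" "\<nu> ''_'' (2 * k) = i"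
      then have "represents \<nu> (env @ [i]) (st i)" using 1 by (intro represents_append) (auto simp: I_def)
      moreover have "st (Suc i) = run p (env @ [i]) (st i)" by (simp add: st_def)
      ultimately obtain t \<nu>1 where 2: "exec (compile (Suc k) p) \<nu> t \<nu>1"
          "t \<le> poly b ?N" "represents \<nu>1 (env @ [i]) (st (Suc i))" "agree_below (Suc k) \<nu> \<nu>1"
        using b[of "env @ [i]" \<nu> "st i"] 1 by (auto simp: st_n)
      have same: "\<nu>1 ''_'' c = \<nu> ''_'' c" if "c < 2 * Suc k" for c
        using 2(4) that by (simp add: agree_below_def)
      have rep: "represents \<nu>1 env (st (Suc i))" using 2(3) by (rule represents_butlast)
      have below: "agree_below k \<mu> \<nu>1"
        using i(2) same by (simp add: I_def agree_below_def)
      show "\<exists>t \<mu>'. exec (compile (Suc k) p) \<nu> t \<mu>' \<and> t \<le> poly b ?N \<and> I (Suc i) \<mu>' \<and> \<mu>' ''n'' 0 = ?N \<and>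
          \<mu>' ''_'' (2 * k) = i"
        using 2 rep below i(4) same by (intro exI conjI) (assumption, auto simp: I_def represents_n st_n)
    next
      fix i \<nu> x assume "I i \<nu>"
      then show "I i (\<nu>(''_'' := (\<nu> ''_'')(2 * k := x)))"
        using 1 by (auto simp: I_def represents_set_scratch agree_below_def)
    next
      show "I 0 \<mu>" using 1 by (auto simp: I_def st_def agree_below_refl)
      show "\<mu> ''n'' 0 = ?N" using 1 by (simp add: represents_n)
    qed
    then show "\<exists>t \<mu>'. exec (compile k (For p)) \<mu> t \<mu>' \<and>
        t \<le> poly ([:2:] + [:0, 1:] * (b + [:2:])) (m ''n'' 0) \<and>
        represents \<mu>' env (run (For p) env m) \<and> agree_below k \<mu> \<mu>'"
      by (auto simp: I_def st_def)
  qed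
qed

text \<open>The compiled program leaves its counters and truth values in \<open>_\<close>; hence the
  last assumption, that correctness of an output is insensitive to this array.\<close>

theorem loop_solves_in_poly_time:
  assumes "wf_loop 0 p"
    and "\<And>x. x \<in> X \<Longrightarrow> input x ''n'' 0 = size_of x"
    and "\<And>x. x \<in> X \<Longrightarrow> correct x (run p [] (input x))"
    and "\<And>x m m'. correct x m \<Longrightarrow> (\<And>a. a \<noteq> ''_'' \<Longrightarrow> m' a = m a) \<Longrightarrow> correct x m'"
  shows "solves_in_poly_time (compile 0 p) X size_of input correct"
proof -
  obtain b where b: "\<And>m \<mu>. represents \<mu> [] m \<Longrightarrow>
     (\<exists>t \<mu>'. exec (compile 0 p) \<mu> t \<mu>' \<and> t \<le> poly b (m ''n'' 0) \<and> represents \<mu>' [] (run p [] m))"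
    using exec_compile[OF assms(1)] by fastforce
  show ?thesis
    unfolding solves_in_poly_time_def
  proof (intro exI[of _ b] ballI)
    fix x assume x: "x \<in> X"
    have "represents (input x) [] (input x)" by (simp add: represents_def)
    from b[OF this] obtain t \<mu>' where "exec (compile 0 p) (input x) t \<mu>'"
        "t \<le> poly b (size_of x)" "represents \<mu>' [] (run p [] (input x))"
      using assms(2)[OF x] by auto
    then show "\<exists>t m. exec (compile 0 p) (input x) t m \<and> t \<le> poly b (size_of x) \<and> correct x m"
      using assms(4)[OF assms(3)[OF x]] unfolding represents_def by blast
  qed
qed

subsection \<open>Graphs that are nearly interval graphs\<close>

definition stable_set :: "('a \<times> 'a) set \<Rightarrow> 'a set \<Rightarrow> bool" where
  "stable_set E U \<longleftrightarrow> (\<forall>u\<in>U. \<forall>w\<in>U. u \<noteq> w \<longrightarrow> (u, w) \<notin> E)"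

lemma stable_set_subset: "stable_set E U \<Longrightarrow> W \<subseteq> U \<Longrightarrow> stable_set E W"
  by (auto simp: stable_set_def)

primrec core :: "'a set \<Rightarrow> ('a \<times> 'a) set \<Rightarrow> nat \<Rightarrow> 'a set" where
  "core V E 0 = V"
| "core V E (Suc k) = {v \<in> core V E k.
     \<exists>U \<subseteq> core V E k. card U = 7 \<and> stable_set E U \<and> U \<subseteq> E `` {v}}"

lemma core_subset: "core V E k \<subseteq> V"
  by (induction k) auto

locale near_interval =
  fixes V :: "'a set" and E :: "('a \<times> 'a) set" and lo hi :: "'a \<Rightarrow> real" and e :: real
  assumes finite_V: "finite V"
    and sym_E: "(u, v) \<in> E \<Longrightarrow> (v, u) \<in> E"
    and irrefl_E: "(v, v) \<notin> E"
    and e_pos: "0 < e"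
    and adjacentI: "u \<in> V \<Longrightarrow> v \<in> V \<Longrightarrow> u \<noteq> v \<Longrightarrow> lo u \<le> hi v \<Longrightarrow> lo v \<le> hi u \<Longrightarrow> (u, v) \<in> E"
    and adjacentD: "u \<in> V \<Longrightarrow> v \<in> V \<Longrightarrow> (u, v) \<in> E \<Longrightarrow> lo u \<le> hi v + e"
    and long: "v \<in> V \<Longrightarrow> 2 * e < hi v - lo v"
begin

text \<open>Mirroring the line preserves all assumptions, so each estimate at left ends also holds
  at right ends.\<close>

lemma reflect: "near_interval V E (\<lambda>v. - hi v) (\<lambda>v. - lo v) e"
proof
  show "- hi u \<le> - lo v + e" if "u \<in> V" "v \<in> V" "(u, v) \<in> E" for u v
    using adjacentD[of v u] that sym_E[of u v] by auto
  show "2 * e < - lo v - - hi v" if "v \<in> V" for v using long that by simp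
qed (use finite_V sym_E irrefl_E e_pos adjacentI in auto)

lemma lo_less_hi: "v \<in> V \<Longrightarrow> lo v < hi v"
  using long e_pos by fastforce

lemma separated: "u \<in> V \<Longrightarrow> v \<in> V \<Longrightarrow> u \<noteq> v \<Longrightarrow> (u, v) \<notin> E \<Longrightarrow> hi u < lo v \<or> hi v < lo u"
  using adjacentI by force

lemma stable_set_chain3:
  assumes "W \<subseteq> V" "stable_set E W" "3 \<le> card W"
  obtains a b c where "a \<in> W" "b \<in> W" "c \<in> W" "hi a < lo b" "hi b < lo c"
proof -
  obtain T where T: "T \<subseteq> W" "card T = 3" using assms(3) by (meson obtain_subset_with_card_n)
  then obtain x y z where xyz: "T = {x, y, z}" "x \<noteq> y" "y \<noteq> z" "x \<noteq> z"
    by (auto simp: card_3_iff)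
  have W: "x \<in> W" "y \<in> W" "z \<in> W" using T xyz by auto
  have "hi x < lo y \<or> hi y < lo x" "hi y < lo z \<or> hi z < lo y" "hi x < lo z \<or> hi z < lo x"
    using assms W xyz separated unfolding stable_set_def by (meson subsetD)+
  moreover have "lo x < hi x" "lo y < hi y" "lo z < hi z" using W assms lo_less_hi by auto
  ultimately have "(hi x < lo y \<and> hi y < lo z) \<or> (hi x < lo z \<and> hi z < lo y) \<or>
      (hi y < lo x \<and> hi x < lo z) \<or> (hi y < lo z \<and> hi z < lo x) \<or>
      (hi z < lo x \<and> hi x < lo y) \<or> (hi z < lo y \<and> hi y < lo x)"
    by (smt (verit))
  then show thesis using that W by blast
qed

text \<open>Order three such neighbors along the line. The middle one fits between the first one and
  \<open>lo v\<close>, so the first one ends more than \<open>2 * e\<close> before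
  \<open>lo v\<close>; adjacency to \<open>v\<close> allows a gap of at most
  \<open>e\<close>.\<close>

lemma card_left_protruding:
  assumes "v \<in> V" "U \<subseteq> V" "stable_set E U" "U \<subseteq> E `` {v}"
  shows "card {u \<in> U. lo u < lo v} \<le> 2"
proof (rule ccontr)
  assume "\<not> ?thesis"
  then have card: "3 \<le> card {u \<in> U. lo u < lo v}" by simp
  have W: "{u \<in> U. lo u < lo v} \<subseteq> V" "stable_set E {u \<in> U. lo u < lo v}"
    using assms(2) stable_set_subset[OF assms(3)] by auto
  obtain a b c where "a \<in> {u \<in> U. lo u < lo v}" "b \<in> {u \<in> U. lo u < lo v}"
      "c \<in> {u \<in> U. lo u < lo v}" "hi a < lo b" "hi b < lo c"
    by (rule stable_set_chain3[OF W card])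
  then have abc: "a \<in> U" "b \<in> U" "c \<in> U" "lo c < lo v" "hi a < lo b" "hi b < lo c" by auto
  then have "lo v \<le> hi a + e" using adjacentD[of v a] assms by auto
  moreover have "2 * e < hi b - lo b" using long abc assms by auto
  ultimately show False using abc e_pos by linarith
qed

definition inside :: "'a \<Rightarrow> 'a set" where
  "inside v = {w \<in> V. lo v \<le> lo w \<and> hi w \<le> hi v}"

lemma core_Suc_inside:
  assumes "v \<in> core V E (Suc k)"
  obtains a c where "a \<in> core V E k" "c \<in> core V E k" "a \<in> inside v" "c \<in> inside v" "hi a + 2 * e < lo c"
proof -
  obtain U where U: "U \<subseteq> core V E k" "card U = 7" "stable_set E U" "U \<subseteq> E `` {v}"
    using assms by auto
  have V: "v \<in> V" "U \<subseteq> V"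
    using subsetD[OF core_subset assms] subset_trans[OF U(1) core_subset] by auto
  let ?W = "{u \<in> U. u \<in> inside v}"
  have "card {u \<in> U. lo u < lo v} \<le> 2" using card_left_protruding V U by blast
  moreover have "card {u \<in> U. hi v < hi u} \<le> 2"
    using near_interval.card_left_protruding[OF reflect V U(3,4)] by simp
  moreover have "U = {u \<in> U. lo u < lo v} \<union> {u \<in> U. hi v < hi u} \<union> ?W"
    using V by (auto simp: inside_def)
  then have "card U = card ({u \<in> U. lo u < lo v} \<union> {u \<in> U. hi v < hi u} \<union> ?W)"
    by (rule arg_cong)
  then have "card U \<le> card {u \<in> U. lo u < lo v} + card {u \<in> U. hi v < hi u} + card ?W"
    using card_Un_le[of "{u \<in> U. lo u < lo v} \<union> {u \<in> U. hi v < hi u}" ?W]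
      card_Un_le[of "{u \<in> U. lo u < lo v}" "{u \<in> U. hi v < hi u}"] by linarith
  ultimately have card: "3 \<le> card ?W" using U(2) by linarith
  have W: "?W \<subseteq> V" "stable_set E ?W" using V stable_set_subset[OF U(3)] by auto
  obtain a b c where abc: "a \<in> ?W" "b \<in> ?W" "c \<in> ?W" "hi a < lo b" "hi b < lo c"
    by (rule stable_set_chain3[OF W card])
  \<comment> \<open>The witnesses are the outer two of the three; the interval of the middle one
    alone makes their gap exceed \<open>2 * e\<close>.\<close>
  then have "2 * e < hi b - lo b" using long V by auto
  then show thesis using that[of a c] abc U by auto
qed

text \<open>Each time a vertex survives a round, the part of the graph inside its interval needs one more
  color: two far apart vertices inside it survived the previous round.\<close>

lemma core_colors:
  assumes P3: "\<And>u v w. u \<in> V \<Longrightarrow> v \<in> V \<Longrightarrow> w \<in> V \<Longrightarrow> c u = c v \<Longrightarrow> c w = c v \<Longrightarrow>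
      (u, v) \<in> E \<Longrightarrow> (v, w) \<in> E \<Longrightarrow> u \<noteq> w \<Longrightarrow> (u, w) \<in> E"
  shows "v \<in> core V E k \<Longrightarrow> k < card (c ` inside v)"
proof (induction k arbitrary: v)
  case 0
  then have "c v \<in> c ` inside v" by (auto simp: inside_def)
  moreover have "finite (inside v)" using finite_V by (simp add: inside_def)
  ultimately show ?case by (metis card_gt_0_iff empty_iff finite_imageI)
next
  case (Suc k)
  then obtain a b where ab: "a \<in> core V E k" "b \<in> core V E k" "a \<in> inside v" "b \<in> inside v"
      "hi a + 2 * e < lo b"
    using core_Suc_inside by blast
  have v: "v \<in> V" using subsetD[OF core_subset Suc.prems] .
  have sub: "inside a \<subseteq> inside v" "inside b \<subseteq> inside v" using ab by (auto simp: inside_def)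
  have fin: "finite (c ` inside v)" using finite_V by (simp add: inside_def)
  show ?case
  proof (rule ccontr)
    assume "\<not> ?thesis"
    then have "card (c ` inside v) \<le> card (c ` inside a)" "card (c ` inside v) \<le> card (c ` inside b)"
      using Suc.IH[OF ab(1)] Suc.IH[OF ab(2)] by auto
    \<comment> \<open>If \<open>v\<close> gains no color over \<open>a\<close> and \<open>b\<close>,
      the three color sets coincide. The color of \<open>v\<close> then recurs at some
      \<open>x\<close> inside \<open>a\<close> and some \<open>y\<close> inside \<open>b\<close>.
      Both are adjacent to \<open>v\<close> but too far apart to be adjacent to each other: an
      induced path in one color.\<close>
    then have "c ` inside a = c ` inside v" "c ` inside b = c ` inside v"
      using sub fin by (metis card_seteq image_mono)+
    moreover have "c v \<in> c ` inside v" using v by (simp add: inside_def)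
    ultimately obtain x y where xy: "x \<in> inside a" "y \<in> inside b" "c x = c v" "c y = c v"
      by (metis imageE)
    have V: "x \<in> V" "y \<in> V" "a \<in> V" "b \<in> V" using xy ab by (auto simp: inside_def)
    have len: "lo x < hi x" "lo y < hi y" using V lo_less_hi by auto
    have gap: "hi x + 2 * e < lo y" using xy ab(5) by (auto simp: inside_def)
    have ord: "lo v \<le> lo x" "hi y \<le> hi v" using xy sub by (auto simp: inside_def)
    have "x \<noteq> v" "y \<noteq> v" "x \<noteq> y" using gap len ord e_pos by auto
    moreover have "(x, v) \<in> E" "(v, y) \<in> E"
      using V v len gap ord e_pos \<open>x \<noteq> v\<close> \<open>y \<noteq> v\<close> by (auto intro!: adjacentI)
    ultimately have "(y, x) \<in> E" using P3[of x v y] V v xy sym_E by auto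
    then show False using adjacentD[of y x] V gap e_pos by auto
  qed
qed

end

section \<open>Coloring each level with boundedly many colors\<close>

definition touch :: "('a \<times> 'a) set \<Rightarrow> ('a \<Rightarrow> nat) \<Rightarrow> 'a \<Rightarrow> 'a \<Rightarrow> bool" where
  "touch E lev u v \<longleftrightarrow> lev u = lev v \<and> (u = v \<or> (u, v) \<in> E)"

text \<open>A walk of length at most 3 within a level, equality counting as touching. This is the
  reach that matters: if \<open>x\<close> touches \<open>v\<close>, such a walk joins any member of
  \<open>S\<close> touched by \<open>x\<close> to any member touched by \<open>v\<close>.\<close>

definition linked :: "'a set \<Rightarrow> ('a \<times> 'a) set \<Rightarrow> ('a \<Rightarrow> nat) \<Rightarrow> 'a \<Rightarrow> 'a \<Rightarrow> bool" where
  "linked V E lev s t \<longleftrightarrow> (\<exists>u\<in>V. \<exists>w\<in>V. touch E lev s u \<and> touch E lev u w \<and> touch E lev w t)"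

text \<open>An improving move replaces \<open>s\<close> by \<open>u\<close> and \<open>w\<close>; if \<open>s\<close> is not in the set, it merely adds
  the possibly equal vertices \<open>u\<close> and \<open>w\<close>.\<close>

definition improving :: "('a \<times> 'a) set \<Rightarrow> ('a \<Rightarrow> nat) \<Rightarrow> 'a set \<Rightarrow> 'a \<Rightarrow> 'a \<Rightarrow> 'a \<Rightarrow> bool" where
  "improving E lev S s u w \<longleftrightarrow> u \<notin> S \<and> w \<notin> S \<and> (u = w \<longrightarrow> s \<notin> S) \<and> (u \<noteq> w \<longrightarrow> \<not> touch E lev u w) \<and>
     (\<forall>x\<in>S. x \<noteq> s \<longrightarrow> \<not> touch E lev x u \<and> \<not> touch E lev x w)"

text \<open>\<open>lev\<close> is the round in which a vertex is discarded. All levels are treated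
  at once: \<open>touch\<close> ignores edges between different levels, and one set
  \<open>S\<close>, independent within each level, serves for all of them.\<close>

locale leveled_near_interval = near_interval +
  fixes lev :: "'a \<Rightarrow> nat" and S :: "'a set"
  assumes no_star: "v \<in> V \<Longrightarrow> U \<subseteq> {u \<in> V. lev u = lev v} \<Longrightarrow> stable_set E U \<Longrightarrow> U \<subseteq> E `` {v} \<Longrightarrow>
      card U \<noteq> 7"
    and S_subset: "S \<subseteq> V"
    and S_independent: "s \<in> S \<Longrightarrow> t \<in> S \<Longrightarrow> lev s = lev t \<Longrightarrow> (s, t) \<notin> E"
begin

lemma reflect_leveled: "leveled_near_interval V E (\<lambda>v. - hi v) (\<lambda>v. - lo v) e lev S"
  using reflect no_star S_subset S_independent
  by (intro leveled_near_interval.intro leveled_near_interval_axioms.intro)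

lemma touch_sym: "touch E lev u v \<Longrightarrow> touch E lev v u"
  using sym_E by (auto simp: touch_def)

lemma touch_lev: "touch E lev u v \<Longrightarrow> lev v = lev u"
  by (simp add: touch_def)

lemma linked_lev: "linked V E lev s t \<Longrightarrow> lev t = lev s"
  by (auto simp: linked_def touch_def)

lemma touch_lo: "u \<in> V \<Longrightarrow> v \<in> V \<Longrightarrow> touch E lev u v \<Longrightarrow> lo u \<le> hi v + e"
  using adjacentD lo_less_hi[of v] e_pos by (fastforce simp: touch_def)

lemma finite_S: "finite S"
  using S_subset finite_V finite_subset by blast

lemma card_touching: "p \<in> V \<Longrightarrow> card {t \<in> S. touch E lev p t} \<le> 6"
proof (cases "p \<in> S")
  case True
  then have "{t \<in> S. touch E lev p t} \<subseteq> {p}" using S_independent by (auto simp: touch_def)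
  then have "card {t \<in> S. touch E lev p t} \<le> card {p}" by (intro card_mono) auto
  then show ?thesis by simp
next
  case False
  assume p: "p \<in> V"
  show ?thesis
  proof (rule ccontr)
    assume "\<not> ?thesis"
    then have "7 \<le> card {t \<in> S. touch E lev p t}" by simp
    then obtain U where U: "U \<subseteq> {t \<in> S. touch E lev p t}" "card U = 7"
      by (meson obtain_subset_with_card_n)
    have "t \<in> S \<and> lev t = lev p" if "t \<in> U" for t using U(1) that by (auto simp: touch_def)
    then have "stable_set E U" unfolding stable_set_def using S_independent by metis
    moreover have "U \<subseteq> {u \<in> V. lev u = lev p}" "U \<subseteq> E `` {p}"
      using U False S_subset by (auto simp: touch_def)
    ultimately show False using no_star p U(2) by blast
  qed
qed

text \<open>Let \<open>f\<close> be the linked member that starts farthest to the right, reached via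
  \<open>p\<close> and \<open>q\<close>. The interval of any other such \<open>t\<close> lies
  between those of \<open>s\<close> and \<open>f\<close>, and the walk cannot jump over it, so
  \<open>p\<close> or \<open>q\<close> touches \<open>t\<close>. This leaves \<open>f\<close> and at
  most 6 members for each of \<open>p\<close> and \<open>q\<close>.\<close>

lemma card_linked_right:
  assumes s: "s \<in> S"
  shows "card {t \<in> S. linked V E lev s t \<and> hi s < lo t} \<le> 13"
proof (cases "{t \<in> S. linked V E lev s t \<and> hi s < lo t} = {}")
  case True
  then show ?thesis by (simp only: card.empty)
next
  case False
  let ?R = "{t \<in> S. linked V E lev s t \<and> hi s < lo t}"
  have fin: "finite ?R" using finite_S by simp
  have "Max (lo ` ?R) \<in> lo ` ?R" using fin False by (intro Max_in) auto
  then obtain f where f: "f \<in> ?R" "lo f = Max (lo ` ?R)" by auto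
  have max: "lo t \<le> lo f" if "t \<in> ?R" for t using fin that unfolding f(2) by (intro Max_ge) auto
  from f obtain p q where pq: "p \<in> V" "q \<in> V" "touch E lev s p" "touch E lev p q" "touch E lev q f"
    by (auto simp: linked_def)
  have "?R \<subseteq> insert f ({t \<in> S. touch E lev p t} \<union> {t \<in> S. touch E lev q t})"
  proof
    fix t assume t: "t \<in> ?R"
    show "t \<in> insert f ({t \<in> S. touch E lev p t} \<union> {t \<in> S. touch E lev q t})"
    proof (rule ccontr)
      assume neg: "\<not> ?thesis"
      have tS: "t \<in> S" "linked V E lev s t" "hi s < lo t" and fS: "f \<in> S" using t f(1) by auto
      have V: "s \<in> V" "t \<in> V" "f \<in> V" using s tS fS S_subset by auto
      have levs: "lev p = lev s" "lev q = lev s" "lev f = lev s" "lev t = lev s"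
        using touch_lev[OF pq(3)] touch_lev[OF pq(4)] touch_lev[OF pq(5)] linked_lev[OF tS(2)] by auto
      have ne: "t \<noteq> f" "\<not> touch E lev p t" "\<not> touch E lev q t" using neg tS(1) by blast+
      have "(t, f) \<notin> E" using S_independent[OF tS(1) fS] levs by simp
      then have tf: "hi t < lo f"
        using separated[OF V(2,3) ne(1)] max[OF t] lo_less_hi[OF V(3)] lo_less_hi[OF V(2)] by linarith
      have tp: "hi p < lo t \<or> hi t < lo p" "hi q < lo t \<or> hi t < lo q"
        using separated[OF pq(1) V(2)] separated[OF pq(2) V(2)] ne levs by (auto simp: touch_def)
      have "lo p \<le> hi s + e" "lo q \<le> hi p + e" "lo f \<le> hi q + e"
        using touch_lo[OF pq(1) V(1) touch_sym[OF pq(3)]] touch_lo[OF pq(2,1) touch_sym[OF pq(4)]]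
          touch_lo[OF V(3) pq(2) touch_sym[OF pq(5)]] by auto
      \<comment> \<open>Each of \<open>p\<close>, \<open>q\<close>, \<open>f\<close> starts at most
        \<open>e\<close> after the end of its predecessor on the walk. By induction along the walk,
        \<open>p\<close> and \<open>q\<close> start before \<open>hi t\<close> and hence, not
        touching \<open>t\<close>, end before \<open>lo t\<close>; so \<open>f\<close> would start
        before \<open>hi t\<close> too.\<close>
      then show False using tp tf tS(3) long[OF V(2)] e_pos by linarith
    qed
  qed
  then have "card ?R \<le> card (insert f ({t \<in> S. touch E lev p t} \<union> {t \<in> S. touch E lev q t}))"
    using finite_S by (intro card_mono) auto
  also have "\<dots> \<le> Suc (card ({t \<in> S. touch E lev p t} \<union> {t \<in> S. touch E lev q t}))"
    using finite_S by (simp add: card_insert_if)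
  also have "\<dots> \<le> 13"
    using card_Un_le[of "{t \<in> S. touch E lev p t}" "{t \<in> S. touch E lev q t}"] card_touching[OF pq(1)] card_touching[OF pq(2)]
    by linarith
  finally show ?thesis .
qed

lemma card_linked:
  assumes s: "s \<in> S"
  shows "card {t \<in> S. t \<noteq> s \<and> linked V E lev s t} \<le> 26"
proof -
  interpret r: leveled_near_interval V E "\<lambda>v. - hi v" "\<lambda>v. - lo v" e lev S
    by (rule reflect_leveled)
  have "card {t \<in> S. linked V E lev s t \<and> hi t < lo s} \<le> 13" using r.card_linked_right[OF s] by simp
  moreover have "card {t \<in> S. linked V E lev s t \<and> hi s < lo t} \<le> 13" using card_linked_right[OF s] .
  moreover have "{t \<in> S. t \<noteq> s \<and> linked V E lev s t} \<subseteq>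
      {t \<in> S. linked V E lev s t \<and> hi t < lo s} \<union> {t \<in> S. linked V E lev s t \<and> hi s < lo t}"
  proof
    fix t assume t: "t \<in> {t \<in> S. t \<noteq> s \<and> linked V E lev s t}"
    then have "lev t = lev s" using linked_lev by auto
    then have "(t, s) \<notin> E" using S_independent s t by auto
    then show "t \<in> {t \<in> S. linked V E lev s t \<and> hi t < lo s} \<union> {t \<in> S. linked V E lev s t \<and> hi s < lo t}"
      using separated[of t s] t s S_subset by auto
  qed
  then have "card {t \<in> S. t \<noteq> s \<and> linked V E lev s t} \<le>
      card ({t \<in> S. linked V E lev s t \<and> hi t < lo s} \<union> {t \<in> S. linked V E lev s t \<and> hi s < lo t})"
    using finite_S by (intro card_mono) auto
  ultimately show ?thesis
    using card_Un_le[of "{t \<in> S. linked V E lev s t \<and> hi t < lo s}" "{t \<in> S. linked V E lev s t \<and> hi s < lo t}"]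
    by linarith
qed

text \<open>Say \<open>s\<close> lies left of \<open>t\<close>. Touching \<open>t\<close>,
  \<open>u\<close> ends at most \<open>e\<close> before \<open>t\<close> starts; touching
  \<open>s\<close>, \<open>w\<close> starts at most \<open>e\<close> after \<open>s\<close> ends.
  The room between \<open>u\<close> and \<open>w\<close> is thus less than \<open>2 * e\<close>, too
  narrow for \<open>v\<close>.\<close>

lemma no_chain_across_gap:
  assumes V: "u \<in> V" "v \<in> V" "w \<in> V" and st: "s \<in> S" "t \<in> S" "s \<noteq> t"
    and chain: "hi u < lo v" "hi v < lo w"
    and touch: "touch E lev u s" "touch E lev u t" "touch E lev w s" "touch E lev w t"
  shows False
proof -
  have key: False if "s \<in> V" "t \<in> V" "hi s < lo t" "touch E lev u t" "touch E lev w s" for s t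
    using touch_lo[of t u] touch_lo[of w s] that V chain touch_sym[of u t] long[of v] by auto
  have "lev s = lev t" using touch by (auto simp: touch_def)
  then show False
    using separated[of s t] st S_subset S_independent key[of s t] key[of t s] touch by blast
qed

end

definition conflict :: "('a \<times> 'a) set \<Rightarrow> ('a \<Rightarrow> nat) \<Rightarrow> ('a \<Rightarrow> 'a) \<Rightarrow> ('a \<Rightarrow> 'a) \<Rightarrow> 'a \<Rightarrow> 'a \<Rightarrow> bool" where
  "conflict E lev fs ls u w \<longleftrightarrow>
     u \<noteq> w \<and> (u, w) \<notin> E \<and> lev u = lev w \<and> fs u = fs w \<and> ls u = ls w"

text \<open>Any two touched members of \<open>S\<close> can serve as \<open>fs v\<close> and
  \<open>ls v\<close> provided that they coincide only if no other member is touched. The algorithm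
  takes the ones with the smallest and the largest number, since it does not know the order along
  the line.\<close>

locale clustered_near_interval = leveled_near_interval +
  fixes fs ls :: "'a \<Rightarrow> 'a"
  assumes optimal: "s \<in> V \<Longrightarrow> u \<in> V \<Longrightarrow> w \<in> V \<Longrightarrow> \<not> improving E lev S s u w"
    and fs: "v \<in> V \<Longrightarrow> fs v \<in> S \<and> touch E lev v (fs v)"
    and ls: "v \<in> V \<Longrightarrow> ls v \<in> S \<and> touch E lev v (ls v)"
    and unique: "v \<in> V \<Longrightarrow> fs v = ls v \<Longrightarrow> s \<in> S \<Longrightarrow> touch E lev v s \<Longrightarrow> s = fs v"
begin

lemma conflict_fs_neq_ls:
  assumes V: "u \<in> V" "w \<in> V" and uw: "conflict E lev fs ls u w"
  shows "fs u \<noteq> ls u"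
proof
  assume eq: "fs u = ls u"
  have c: "u \<noteq> w" "(u, w) \<notin> E" "fs w = fs u" "ls w = ls u" using uw by (auto simp: conflict_def)
  have u: "s = fs u" if "s \<in> S" "touch E lev u s" for s using unique[OF V(1) eq that] .
  have w: "s = fs u" if "s \<in> S" "touch E lev w s" for s using unique[OF V(2) _ that] eq c by simp
  have tu: "touch E lev u (fs u)" "touch E lev w (fs u)" using fs[OF V(1)] fs[OF V(2)] c by auto
  \<comment> \<open>A member of \<open>S\<close> touches itself. If \<open>u\<close> were one, it
    would be the common vertex \<open>fs u\<close>, which \<open>w\<close> touches, contrary to the
    conflict.\<close>
  have "u \<notin> S" using u[of u] tu c sym_E by (auto simp: touch_def)
  moreover have "w \<notin> S" using w[of w] tu c by (auto simp: touch_def)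
  moreover have "\<not> touch E lev u w" using c by (auto simp: touch_def)
  moreover have "\<forall>x\<in>S. x \<noteq> fs u \<longrightarrow> \<not> touch E lev x u \<and> \<not> touch E lev x w"
    using u w touch_sym by blast
  ultimately have "improving E lev S (fs u) u w" using c by (simp add: improving_def)
  then show False using optimal[of "fs u" u w] V fs[OF V(1)] S_subset by auto
qed

text \<open>Take as \<open>f u\<close> whether some vertex in conflict with \<open>u\<close> lies to
  its right. Vertices in conflict have disjoint intervals, and none has conflicts on both sides, so
  the left vertex of a conflict gets \<open>True\<close> and the right one
  \<open>False\<close>.\<close>

lemma conflict_bipartite:
  obtains f :: "'a \<Rightarrow> bool" where
    "\<And>u w. u \<in> V \<Longrightarrow> w \<in> V \<Longrightarrow> conflict E lev fs ls u w \<Longrightarrow> f u \<noteq> f w"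
proof
  let ?f = "\<lambda>u. \<exists>w\<in>V. conflict E lev fs ls u w \<and> hi u < lo w"
  have no_chain: False if "u \<in> V" "v \<in> V" "w \<in> V" "conflict E lev fs ls u v" "conflict E lev fs ls v w"
      "hi u < lo v" "hi v < lo w" for u v w
  proof -
    have "fs w = fs u" "ls w = ls u" using that by (auto simp: conflict_def)
    then show False
      using no_chain_across_gap[of u v w "fs u" "ls u"] conflict_fs_neq_ls[of u v] that
        fs[of u] ls[of u] fs[of w] ls[of w] by auto
  qed
  have key: "?f u \<and> \<not> ?f w" if "u \<in> V" "w \<in> V" "conflict E lev fs ls u w" "hi u < lo w" for u w
    using that no_chain by blast
  fix u w assume uw: "u \<in> V" "w \<in> V" "conflict E lev fs ls u w"
  then have "conflict E lev fs ls w u" using sym_E by (auto simp: conflict_def)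
  moreover have "hi u < lo w \<or> hi w < lo u" using separated uw by (auto simp: conflict_def)
  ultimately show "?f u \<noteq> ?f w" using key uw by blast
qed

end

subsection \<open>Disks\<close>

text \<open>A disk of the representation meets the diagonal in the points at distance \<open>a\<close> and \<open>b\<close> from the
  origin, where \<open>a * b\<close> is the power \<open>p\<close> of the origin. It lies between distances \<open>D - r\<close> and
  \<open>D + r\<close> from the origin, whose product is \<open>p\<close> too; as \<open>D + r \<le> sqrt 2 * b\<close>, the interval on the
  diagonal determines adjacency up to a factor 2.\<close>

lemma disk_diagonal:
  fixes x y r :: real
  assumes "0 < x" "0 < y" "max x y \<le> r" "r < sqrt (x\<^sup>2 + y\<^sup>2)"
  obtains a b where "0 < a" "4 * a < b"
    "\<And>\<tau>. a \<le> \<tau> \<Longrightarrow> \<tau> \<le> b \<Longrightarrow> (\<tau> / sqrt 2, \<tau> / sqrt 2) \<in> cball (x, y) r"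
    "\<And>z. z \<in> cball (x, y) r \<Longrightarrow> a \<le> sqrt 2 * norm z \<and> norm z \<le> sqrt 2 * b"
proof -
  \<comment> \<open>\<open>D\<close> is the distance of the center from the origin. The numbers
    \<open>a\<close> and \<open>b\<close> are the roots of
    \<open>\<tau>\<^sup>2 - sqrt 2 * (x + y) * \<tau> + p\<close>, the equation for the points of
    the diagonal on the circle; \<open>q\<close> stems from its discriminant.\<close>
  define D where "D = sqrt (x\<^sup>2 + y\<^sup>2)"
  define p where "p = x\<^sup>2 + y\<^sup>2 - r\<^sup>2"
  define q where "q = sqrt ((x + y)\<^sup>2 - 2 * p)"
  define b where "b = (x + y + q) / sqrt 2"
  define a where "a = (x + y - q) / sqrt 2"
  have r: "0 < r" "x \<le> r" "y \<le> r" "r < D" using assms by (auto simp: D_def)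
  have D2: "D\<^sup>2 = x\<^sup>2 + y\<^sup>2" by (simp add: D_def)
  have "r\<^sup>2 < D\<^sup>2" using r by (intro power_strict_mono) auto
  then have p0: "0 < p" using D2 by (simp add: p_def)
  have "x\<^sup>2 \<le> r\<^sup>2" "y\<^sup>2 \<le> r\<^sup>2" using r assms by (auto intro!: power_mono)
  then have "p \<le> x\<^sup>2" "p \<le> y\<^sup>2" by (auto simp: p_def)
  then have "p * p \<le> x\<^sup>2 * y\<^sup>2" using p0 by (intro mult_mono) auto
  then have "p\<^sup>2 \<le> (x * y)\<^sup>2" by (simp add: power2_eq_square algebra_simps)
  \<comment> \<open>Here \<open>max x y \<le> r\<close> enters: it bounds the power of the origin by
    both \<open>x\<^sup>2\<close> and \<open>y\<^sup>2\<close>, hence by \<open>x * y\<close>. As a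
    consequence \<open>q\<close> is at least \<open>D\<close>.\<close>
  then have pxy: "p \<le> x * y" by (rule power2_le_imp_le) (use assms in simp)
  have sq: "(x + y)\<^sup>2 = D\<^sup>2 + 2 * (x * y)" unfolding D2 by (simp add: power2_eq_square algebra_simps)
  have "2 * p \<le> (x + y)\<^sup>2" using sq pxy zero_le_power2[of D] by linarith
  then have q2: "q\<^sup>2 = (x + y)\<^sup>2 - 2 * p" "0 \<le> q" unfolding q_def by auto
  have D0: "0 < D" using r by linarith
  have "D\<^sup>2 \<le> q\<^sup>2" using q2 sq pxy by simp
  then have qD: "D \<le> q" using q2(2) by (rule power2_le_imp_le)
  have "D\<^sup>2 \<le> (x + y)\<^sup>2" using sq pxy p0 by linarith
  then have xyD: "D \<le> x + y" by (rule power2_le_imp_le) (use assms in simp)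
  have ab: "a * b = p"
  proof -
    have "a * b = ((x + y - q) * (x + y + q)) / (sqrt 2 * sqrt 2)"
      unfolding a_def b_def by (rule times_divide_times_eq)
    also have "(x + y - q) * (x + y + q) = (x + y)\<^sup>2 - q\<^sup>2"
      by (simp add: power2_eq_square algebra_simps)
    finally have "a * b = ((x + y)\<^sup>2 - q\<^sup>2) / (sqrt 2 * sqrt 2)" .
    then show ?thesis using q2 by simp
  qed
  have b0: "0 < b" using xyD qD D0 by (simp add: b_def)
  then have "0 < a" using ab p0 by (metis zero_less_mult_pos2)
  have Db: "D + r \<le> sqrt 2 * b" using xyD qD r by (simp add: b_def)
  show thesis
  proof
    show "0 < a" by fact
    \<comment> \<open>Since \<open>a * b = p\<close>, this amounts to
      \<open>4 * p < b\<^sup>2\<close>. Both \<open>x + y\<close> and \<open>q\<close> are large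
      compared with \<open>sqrt p\<close>, so crude estimates suffice.\<close>
    show "4 * a < b"
    proof -
      have "4 * p \<le> (x + y)\<^sup>2"
        using pxy zero_le_power2[of "x - y"] by (simp add: power2_eq_square algebra_simps)
      then have "2 * p \<le> q\<^sup>2" using q2 by simp
      have "(2 * b)\<^sup>2 > 16 * p"
      proof -
        have "b\<^sup>2 = (x + y + q)\<^sup>2 / 2" unfolding b_def by (simp only: power_divide) simp
        then have "(2 * b)\<^sup>2 = 2 * (x + y + q)\<^sup>2" by (simp only: power_mult_distrib) simp
        also have "(x + y + q)\<^sup>2 = (x + y)\<^sup>2 + q\<^sup>2 + 2 * ((x + y) * q)"
          by (simp add: power2_eq_square algebra_simps)
        finally have expand: "(2 * b)\<^sup>2 = 2 * ((x + y)\<^sup>2 + q\<^sup>2 + 2 * ((x + y) * q))" .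
        have "2 * p < (x + y) * q"
        proof -
          have "(2 * p)\<^sup>2 < ((x + y) * q)\<^sup>2"
          proof -
            have "(4 * p) * (2 * p) \<le> (x + y)\<^sup>2 * q\<^sup>2"
              using \<open>4 * p \<le> (x + y)\<^sup>2\<close> \<open>2 * p \<le> q\<^sup>2\<close> p0 by (intro mult_mono) auto
            moreover have "(2 * p)\<^sup>2 < (4 * p) * (2 * p)" using p0 by (simp add: power2_eq_square)
            ultimately show ?thesis by (simp add: power_mult_distrib)
          qed
          then show ?thesis by (rule power2_less_imp_less) (use assms q2 in simp)
        qed
        moreover have "16 * p < 2 * (A + B + 2 * C)" if "2 * p < C" "4 * p \<le> A" "2 * p \<le> B" for A B C
          using that p0 by (simp add: algebra_simps)
        ultimately show ?thesis
          unfolding expand using \<open>4 * p \<le> (x + y)\<^sup>2\<close> \<open>2 * p \<le> q\<^sup>2\<close> by blast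
      qed
      then have "4 * (a * b) < b * b" using ab by (simp add: power2_eq_square)
      then show ?thesis using b0 by (simp add: mult.assoc[symmetric])
    qed
    show "(\<tau> / sqrt 2, \<tau> / sqrt 2) \<in> cball (x, y) r" if "a \<le> \<tau>" "\<tau> \<le> b" for \<tau>
    proof -
      have "(\<tau> - a) * (\<tau> - b) \<le> 0" using that by (simp add: mult_nonneg_nonpos)
      then have "\<tau>\<^sup>2 - \<tau> * (a + b) + p \<le> 0" using ab by (simp add: power2_eq_square algebra_simps)
      moreover have "a + b = sqrt 2 * (x + y)"
        by (simp add: a_def b_def field_simps)
      moreover have "(x - \<tau> / sqrt 2)\<^sup>2 + (y - \<tau> / sqrt 2)\<^sup>2
          = \<tau>\<^sup>2 - \<tau> * (sqrt 2 * (x + y)) + (p + r\<^sup>2)"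
      proof -
        define w where "w = \<tau> / sqrt 2"
        have \<tau>: "\<tau> = sqrt 2 * w" by (simp add: w_def)
        have "\<tau> * (sqrt 2 * (x + y)) = (sqrt 2 * sqrt 2) * (w * (x + y))"
          unfolding \<tau> by (simp only: ac_simps)
        moreover have "\<tau>\<^sup>2 = 2 * w\<^sup>2" unfolding \<tau> by (simp add: power_mult_distrib)
        ultimately show ?thesis
          unfolding w_def[symmetric] p_def by (simp add: power2_eq_square algebra_simps)
      qed
      ultimately have "(x - \<tau> / sqrt 2)\<^sup>2 + (y - \<tau> / sqrt 2)\<^sup>2 \<le> r\<^sup>2" by simp
      then show ?thesis
        using r by (simp add: dist_Pair_Pair dist_real_def real_sqrt_le_iff real_le_lsqrt)
    qed
    show "a \<le> sqrt 2 * norm z \<and> norm z \<le> sqrt 2 * b" if "z \<in> cball (x, y) r" for z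
    proof -
      have "dist (x, y) z \<le> r" using that by simp
      moreover have "norm (x, y) = D" by (simp add: norm_Pair D_def)
      ultimately have z: "D - r \<le> norm z" "norm z \<le> D + r"
        using norm_triangle_ineq2[of "(x, y)" z] norm_triangle_ineq2[of z "(x, y)"]
        by (auto simp: dist_norm norm_minus_commute)
      \<comment> \<open>The lower estimate mirrors the upper one: as this product equals
        \<open>a * b\<close>, the factor \<open>sqrt 2\<close> between \<open>D + r\<close> and
        \<open>b\<close> is also all that is lost between \<open>a\<close> and
        \<open>D - r\<close>.\<close>
      have "(D + r) * (D - r) = p" using D2 by (simp add: p_def power2_eq_square algebra_simps)
      then have "a * b \<le> (sqrt 2 * b) * (D - r)"
        using ab Db r by (metis diff_gt_0_iff_gt less_eq_real_def mult_right_mono)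
      then have "a \<le> sqrt 2 * (D - r)" using b0 by (simp add: mult.commute mult.left_commute)
      then have "a \<le> sqrt 2 * norm z" using z(1) by (smt (verit) mult_left_mono real_sqrt_ge_zero)
      then show ?thesis using z(2) Db by linarith
    qed
  qed
qed

text \<open>Logarithms turn factors into distances. A common point of two disks loses a factor
  \<open>sqrt 2\<close> against each diagonal interval, in total 2, whence \<open>e = ln 2\<close>;
  the factor 4 between the ends of an interval gives length more than
  \<open>2 * ln 2\<close>.\<close>

lemma delta_disk_graph_near_interval:
  assumes "delta_disk_graph G"
  obtains lo hi where "near_interval (pverts G) (parcs G) lo hi (ln 2)"
proof -
  obtain x y r where G: "pair_graph G"
    and disk: "\<forall>v\<in>pverts G. 0 < x v \<and> 0 < y v \<and> max (x v) (y v) \<le> r v \<and>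
        r v < sqrt ((x v)\<^sup>2 + (y v)\<^sup>2)"
    and adj: "\<forall>u\<in>pverts G. \<forall>v\<in>pverts G. u \<noteq> v \<longrightarrow>
        ((u, v) \<in> parcs G \<longleftrightarrow> cball (x u, y u) (r u) \<inter> cball (x v, y v) (r v) \<noteq> {})"
    using assms unfolding delta_disk_graph_def by (elim conjE exE)
  interpret pair_graph G by (rule G)
  have "\<exists>a b. v \<in> pverts G \<longrightarrow> 0 < a \<and> 4 * a < b \<and>
      (\<forall>\<tau>. a \<le> \<tau> \<longrightarrow> \<tau> \<le> b \<longrightarrow> (\<tau> / sqrt 2, \<tau> / sqrt 2) \<in> cball (x v, y v) (r v)) \<and>
      (\<forall>z. z \<in> cball (x v, y v) (r v) \<longrightarrow> a \<le> sqrt 2 * norm z \<and> norm z \<le> sqrt 2 * b)" for v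
  proof (cases "v \<in> pverts G")
    case True
    obtain a b where "0 < a" "4 * a < b"
      "\<And>\<tau>. a \<le> \<tau> \<Longrightarrow> \<tau> \<le> b \<Longrightarrow> (\<tau> / sqrt 2, \<tau> / sqrt 2) \<in> cball (x v, y v) (r v)"
      "\<And>z. z \<in> cball (x v, y v) (r v) \<Longrightarrow> a \<le> sqrt 2 * norm z \<and> norm z \<le> sqrt 2 * b"
      by (rule disk_diagonal[of "x v" "y v" "r v"]) (use disk True in auto)
    then show ?thesis by blast
  qed simp
  then obtain a b where ab: "\<And>v. v \<in> pverts G \<Longrightarrow> 0 < a v \<and> 4 * a v < b v"
    and diag: "\<And>v \<tau>. v \<in> pverts G \<Longrightarrow> a v \<le> \<tau> \<Longrightarrow> \<tau> \<le> b v \<Longrightarrow>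
        (\<tau> / sqrt 2, \<tau> / sqrt 2) \<in> cball (x v, y v) (r v)"
    and norm: "\<And>v z. v \<in> pverts G \<Longrightarrow> z \<in> cball (x v, y v) (r v) \<Longrightarrow>
        a v \<le> sqrt 2 * norm z \<and> norm z \<le> sqrt 2 * b v"
    by metis
  have pos: "0 < a v" "0 < b v" "a v \<le> b v" if "v \<in> pverts G" for v using ab[OF that] by auto
  have irrefl: "(v, v) \<notin> parcs G" for v using no_loops[of "(v, v)"] by auto
  have "near_interval (pverts G) (parcs G) (\<lambda>v. ln (a v)) (\<lambda>v. ln (b v)) (ln 2)"
  proof
    show "finite (pverts G)" by simp
    show "(v, u) \<in> parcs G" if "(u, v) \<in> parcs G" for u v using that arcs_symmetric by blast
    show "(v, v) \<notin> parcs G" for v by (rule irrefl)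
    show "0 < ln (2::real)" by simp
    show "(u, v) \<in> parcs G"
      if uv: "u \<in> pverts G" "v \<in> pverts G" "u \<noteq> v" "ln (a u) \<le> ln (b v)" "ln (a v) \<le> ln (b u)" for u v
    proof -
      define \<tau> where "\<tau> = max (a u) (a v)"
      have "a u \<le> b v" "a v \<le> b u" using uv pos by auto
      then have "a u \<le> \<tau>" "a v \<le> \<tau>" "\<tau> \<le> b u" "\<tau> \<le> b v" using pos uv by (auto simp: \<tau>_def)
      then have "(\<tau> / sqrt 2, \<tau> / sqrt 2) \<in> cball (x u, y u) (r u) \<inter> cball (x v, y v) (r v)"
        using diag uv(1,2) by blast
      then show ?thesis using adj uv(1-3) by blast
    qed
    show "ln (a u) \<le> ln (b v) + ln 2" if uv: "u \<in> pverts G" "v \<in> pverts G" "(u, v) \<in> parcs G" for u v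
    proof -
      have "u \<noteq> v" using uv irrefl by auto
      then obtain z where "z \<in> cball (x u, y u) (r u)" "z \<in> cball (x v, y v) (r v)"
        using adj uv by blast
      then have "a u \<le> sqrt 2 * norm z" "norm z \<le> sqrt 2 * b v" using norm uv by blast+
      then have "a u \<le> sqrt 2 * (sqrt 2 * b v)" by (smt (verit) mult_left_mono real_sqrt_ge_zero)
      then have "a u \<le> b v * 2" by (simp add: mult.assoc[symmetric])
      then have "ln (a u) \<le> ln (b v * 2)" using pos uv by (subst ln_le_cancel_iff) auto
      then show ?thesis using pos(2)[OF uv(2)] by (simp add: ln_mult)
    qed
    show "2 * ln 2 < ln (b v) - ln (a v)" if "v \<in> pverts G" for v
    proof -
      have "2 * ln 2 = ln (4 :: real)" using ln_realpow[of "2 :: real" 2] by simp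
      moreover have "ln (4 * a v) < ln (b v)" using ab[OF that] by (subst ln_less_cancel_iff) auto
      moreover have "ln (4 * a v) = ln 4 + ln (a v)" using pos[OF that] by (intro ln_mult_pos) auto
      ultimately show ?thesis by simp
    qed
  qed
  then show thesis by (rule that)
qed

subsection \<open>Reasoning about loop programs\<close>

primrec written :: "loop \<Rightarrow> string set" where
  "written (Assign a s t) = {a}"
| "written (Then p q) = written p \<union> written q"
| "written (When \<phi> p) = written p"
| "written (For p) = written p"

lemma run_unwritten: "a \<notin> written p \<Longrightarrow> run p env m a = m a"
proof (induction p arbitrary: env m)
  case (For p)
  have "fold (\<lambda>i. run p (env @ [i])) xs m a = m a" for xs
    by (induction xs arbitrary: m) (use For in auto)
  then show ?case by simp
qed auto

lemma fold_upt_invariant: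
  "P 0 s \<Longrightarrow> (\<And>i s. i < n \<Longrightarrow> P i s \<Longrightarrow> P (Suc i) (f i s)) \<Longrightarrow> P n (fold f [0..<n] s)"
  by (induction n) auto

lemma run_For_invariant:
  assumes "m ''n'' 0 = n" "P 0 m" "\<And>i m. i < n \<Longrightarrow> P i m \<Longrightarrow> P (Suc i) (run p (env @ [i]) m)"
  shows "P n (run (For p) env m)"
  using assms by (simp add: fold_upt_invariant)

text \<open>A sweep tries all local improvements in turn; \<open>Q\<close> says that none of them applies. Repeating
  sweeps decreases the potential \<open>\<Phi>\<close> by one per round until \<open>Q\<close> holds.\<close>

definition sweep :: "loop \<Rightarrow> nat list \<Rightarrow> (memory \<Rightarrow> bool) \<Rightarrow> (memory \<Rightarrow> nat) \<Rightarrow> (memory \<Rightarrow> bool) \<Rightarrow> bool" where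
  "sweep p env Inv \<Phi> Q \<longleftrightarrow> (\<forall>m. Inv m \<longrightarrow> Inv (run p env m) \<and>
     (if Q m then run p env m = m else \<Phi> (run p env m) < \<Phi> m))"

definition rounds :: "loop \<Rightarrow> nat list \<Rightarrow> (memory \<Rightarrow> bool) \<Rightarrow> (memory \<Rightarrow> nat) \<Rightarrow> nat \<Rightarrow> (memory \<Rightarrow> bool) \<Rightarrow> bool" where
  "rounds p env Inv \<Phi> d Q \<longleftrightarrow> (\<forall>m. Inv m \<longrightarrow> Inv (run p env m) \<and>
     (if Q m then run p env m = m else Q (run p env m) \<or> \<Phi> (run p env m) + d \<le> \<Phi> m))"

text \<open>Up to the first failing \<open>Q i\<close> the memory is still the initial one, so the
  test there is the one at the start. That step lowers the potential, and no later step raises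
  it.\<close>

lemma sweep_For:
  assumes n: "\<And>m. Inv m \<Longrightarrow> m ''n'' 0 = n"
    and body: "\<And>i. i < n \<Longrightarrow> sweep p (env @ [i]) Inv \<Phi> (Q i)"
  shows "sweep (For p) env Inv \<Phi> (\<lambda>m. \<forall>i<n. Q i m)"
  unfolding sweep_def
proof (intro allI impI)
  fix m assume m: "Inv m"
  define P where "P = (\<lambda>k m'. Inv m' \<and> (if \<forall>i<k. Q i m then m' = m else \<Phi> m' < \<Phi> m))"
  have "P n (run (For p) env m)"
  proof (rule run_For_invariant)
    show "m ''n'' 0 = n" using n m .
    show "P 0 m" using m by (simp add: P_def)
    fix i m' assume i: "i < n" and P: "P i m'"
    then have s: "Inv (run p (env @ [i]) m')"
        "if Q i m' then run p (env @ [i]) m' = m' else \<Phi> (run p (env @ [i]) m') < \<Phi> m'"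
      using body[OF i] unfolding sweep_def P_def by blast+
    show "P (Suc i) (run p (env @ [i]) m')"
    proof (cases "\<forall>j<i. Q j m")
      case True
      then have "m' = m" using P by (simp add: P_def)
      then show ?thesis using s True by (auto simp: P_def less_Suc_eq split: if_splits)
    next
      case False
      then have "\<Phi> m' < \<Phi> m" using P by (simp only: P_def if_False)
      moreover have "\<not> (\<forall>j<Suc i. Q j m)" using False less_SucI by blast
      moreover have "\<Phi> (run p (env @ [i]) m') \<le> \<Phi> m'" using s(2) by (auto split: if_splits)
      ultimately show ?thesis using s(1) unfolding P_def by (simp only: if_False) simp
    qed
  qed
  then show "Inv (run (For p) env m) \<and>
      (if \<forall>i<n. Q i m then run (For p) env m = m else \<Phi> (run (For p) env m) < \<Phi> m)"
    unfolding P_def .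
qed

lemma sweep_imp_rounds: "sweep p env Inv \<Phi> Q \<Longrightarrow> rounds p env Inv \<Phi> 1 Q"
  unfolding sweep_def rounds_def by (metis Suc_eq_plus1 Suc_leI)

text \<open>\<open>d\<close> is the drop guaranteed by one run unless \<open>Q\<close> is reached.
  Repetition adds up the drops, so nested loops whose variables merely count multiply their ranges;
  \<open>Q\<close>, once reached, stays.\<close>

lemma rounds_For:
  assumes n: "\<And>m. Inv m \<Longrightarrow> m ''n'' 0 = n"
    and body: "\<And>i. i < n \<Longrightarrow> rounds p (env @ [i]) Inv \<Phi> d Q"
  shows "rounds (For p) env Inv \<Phi> (n * d) Q"
  unfolding rounds_def
proof (intro allI impI)
  fix m assume m: "Inv m"
  define P where "P = (\<lambda>k m'. Inv m' \<and> (if Q m then m' = m else Q m' \<or> \<Phi> m' + k * d \<le> \<Phi> m))"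
  have "P n (run (For p) env m)"
  proof (rule run_For_invariant)
    show "m ''n'' 0 = n" using n m .
    show "P 0 m" using m by (simp add: P_def)
    fix i m' assume i: "i < n" and P: "P i m'"
    then have s: "Inv (run p (env @ [i]) m')"
        "if Q m' then run p (env @ [i]) m' = m'
         else Q (run p (env @ [i]) m') \<or> \<Phi> (run p (env @ [i]) m') + d \<le> \<Phi> m'"
      using body[OF i] unfolding rounds_def P_def by blast+
    then show "P (Suc i) (run p (env @ [i]) m')"
      using P by (auto simp: P_def split: if_splits)
  qed
  then show "Inv (run (For p) env m) \<and> (if Q m then run (For p) env m = m
      else Q (run (For p) env m) \<or> \<Phi> (run (For p) env m) + n * d \<le> \<Phi> m)"
    unfolding P_def .
qed

lemma rounds_reach:
  assumes "rounds p env Inv \<Phi> d Q" "Inv m" "\<Phi> m \<le> d" "\<And>m. Inv m \<Longrightarrow> \<Phi> m = 0 \<Longrightarrow> Q m"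
  shows "Inv (run p env m)" "Q (run p env m)"
proof -
  have *: "Inv (run p env m)" "if Q m then run p env m = m else Q (run p env m) \<or> \<Phi> (run p env m) + d \<le> \<Phi> m"
    using assms(1,2) unfolding rounds_def by blast+
  then show "Inv (run p env m)" "Q (run p env m)"
    using assms(3) assms(4)[OF *(1)] by (auto split: if_splits)
qed

text \<open>The loops search for the unique \<open>s\<close> with \<open>R v s\<close> while filling
  \<open>a\<close>. Hence the test has to mean \<open>R\<close> in every memory that differs from
  \<open>m\<close> in \<open>a\<close> only.\<close>

lemma run_select:
  assumes n: "m ''n'' 0 = n" and a: "a \<noteq> ''n''"
    and sat: "\<And>m' v s. (\<And>b. b \<noteq> a \<Longrightarrow> m' b = m b) \<Longrightarrow> v < n \<Longrightarrow> s < n \<Longrightarrow> sat \<phi> [v, s] m' \<longleftrightarrow> R v s"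
    and unique: "\<And>v s s'. v < n \<Longrightarrow> s < n \<Longrightarrow> s' < n \<Longrightarrow> R v s \<Longrightarrow> R v s' \<Longrightarrow> s = s'"
    and vs: "v < n" "s < n" "R v s"
  shows "run (For (For (When \<phi> (Assign a (Var 0) (Var 1))))) [] m a v = s"
proof -
  define P where "P = (\<lambda>i m'. (\<forall>b. b \<noteq> a \<longrightarrow> m' b = m b) \<and> (\<forall>v s. v < i \<longrightarrow> s < n \<longrightarrow> R v s \<longrightarrow> m' a v = s))"
  have "P n (run (For (For (When \<phi> (Assign a (Var 0) (Var 1))))) [] m)"
  proof (rule run_For_invariant)
    show "m ''n'' 0 = n" by (rule n)
    show "P 0 m" by (simp add: P_def)
    fix v m1 assume v: "v < n" and P: "P v m1"
    define P' where "P' = (\<lambda>j m'. P v m' \<and> (\<forall>s<j. R v s \<longrightarrow> m' a v = s))"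
    have "P' n (run (For (When \<phi> (Assign a (Var 0) (Var 1)))) ([] @ [v]) m1)"
    proof (rule run_For_invariant)
      show "m1 ''n'' 0 = n" using P n a by (auto simp: P_def)
      show "P' 0 m1" using P by (simp add: P'_def)
      fix j m2 assume j: "j < n" and P': "P' j m2"
      have same: "\<And>b. b \<noteq> a \<Longrightarrow> m2 b = m b" using P' by (simp add: P'_def P_def)
      have "sat \<phi> [v, j] m2 \<longleftrightarrow> R v j" by (rule sat[OF same v j])
      then show "P' (Suc j) (run (When \<phi> (Assign a (Var 0) (Var 1))) (([] @ [v]) @ [j]) m2)"
        using P' unique[OF v j _] v j by (auto simp: P'_def P_def less_Suc_eq)
    qed
    then show "P (Suc v) (run (For (When \<phi> (Assign a (Var 0) (Var 1)))) ([] @ [v]) m1)"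
      unfolding P'_def P_def by (auto simp: less_Suc_eq)
  qed
  then show ?thesis using vs by (simp add: P_def)
qed

section \<open>Graph predicates as bounded formulas\<close>

abbreviation Disj :: "fm \<Rightarrow> fm \<Rightarrow> fm" where
  "Disj \<phi> \<psi> \<equiv> Neg (Conj (Neg \<phi>) (Neg \<psi>))"

primrec Conjs :: "fm list \<Rightarrow> fm" where
  "Conjs [] = Equal (Lit 0) (Lit 0)"
| "Conjs (\<phi> # \<phi>s) = Conj \<phi> (Conjs \<phi>s)"

lemma sat_Conjs [simp]: "sat (Conjs \<phi>s) env m \<longleftrightarrow> (\<forall>\<phi>\<in>set \<phi>s. sat \<phi> env m)"
  by (induction \<phi>s) auto

lemma wf_Conjs [simp]: "wf_fm k (Conjs \<phi>s) \<longleftrightarrow> (\<forall>\<phi>\<in>set \<phi>s. wf_fm k \<phi>)"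
  by (induction \<phi>s) auto

lemma sat_Exists_funpow:
  "sat ((Exists ^^ k) \<phi>) env m \<longleftrightarrow>
    (\<exists>us. length us = k \<and> set us \<subseteq> {..<m ''n'' 0} \<and> sat \<phi> (env @ us) m)"
proof (induction k arbitrary: env)
  case (Suc k)
  show ?case
  proof
    assume "sat ((Exists ^^ Suc k) \<phi>) env m"
    then obtain i us where "i < m ''n'' 0" "length us = k" "set us \<subseteq> {..<m ''n'' 0}"
        "sat \<phi> (env @ [i] @ us) m"
      using Suc by auto
    then show "\<exists>us. length us = Suc k \<and> set us \<subseteq> {..<m ''n'' 0} \<and> sat \<phi> (env @ us) m"
      by (intro exI[of _ "i # us"]) auto
  next
    assume "\<exists>us. length us = Suc k \<and> set us \<subseteq> {..<m ''n'' 0} \<and> sat \<phi> (env @ us) m"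
    then obtain i us where "length us = k" "set (i # us) \<subseteq> {..<m ''n'' 0}" "sat \<phi> (env @ i # us) m"
      by (metis length_Suc_conv)
    then show "sat ((Exists ^^ Suc k) \<phi>) env m"
      using Suc by auto
  qed
qed auto

lemma wf_Exists_funpow [simp]: "wf_fm k ((Exists ^^ j) \<phi>) \<longleftrightarrow> wf_fm (k + j) \<phi>"
  by (induction j arbitrary: k) auto

text \<open>The machine cannot multiply in one step, so the offset \<open>i * n\<close> of a matrix
  row is read from the table \<open>row\<close>, filled beforehand by
  \<open>row_loop\<close>.\<close>

definition Adj :: "tm \<Rightarrow> tm \<Rightarrow> fm" where
  "Adj i j = Less (Lit 0) (Arr ''adj'' (Add (Arr ''row'' i) j))"

definition Same :: "string \<Rightarrow> tm \<Rightarrow> tm \<Rightarrow> fm" where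
  "Same a i j = Equal (Arr a i) (Arr a j)"

definition Touch :: "tm \<Rightarrow> tm \<Rightarrow> fm" where
  "Touch i j = Conj (Same ''lev'' i j) (Disj (Equal i j) (Adj i j))"

definition InS :: "tm \<Rightarrow> fm" where
  "InS i = Less (Lit 0) (Arr ''S'' i)"

definition holds_graph :: "nat \<Rightarrow> (nat \<times> nat) set \<Rightarrow> memory \<Rightarrow> bool" where
  "holds_graph n E m \<longleftrightarrow> m ''n'' 0 = n \<and> (\<forall>v<n. m ''row'' v = v * n) \<and>
     (\<forall>u<n. \<forall>v<n. 0 < m ''adj'' (u * n + v) \<longleftrightarrow> (u, v) \<in> E)"

definition S_set :: "nat \<Rightarrow> memory \<Rightarrow> nat set" where
  "S_set n m = {v. v < n \<and> 0 < m ''S'' v}"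

lemma holds_graph_n: "holds_graph n E m \<Longrightarrow> m ''n'' 0 = n"
  by (simp add: holds_graph_def)

lemma holds_graph_cong:
  "holds_graph n E m \<Longrightarrow> m' ''n'' = m ''n'' \<Longrightarrow> m' ''row'' = m ''row'' \<Longrightarrow> m' ''adj'' = m ''adj'' \<Longrightarrow>
    holds_graph n E m'"
  by (simp add: holds_graph_def)

lemma sat_Adj:
  "holds_graph n E m \<Longrightarrow> tval i env m < n \<Longrightarrow> tval j env m < n \<Longrightarrow>
    sat (Adj i j) env m \<longleftrightarrow> (tval i env m, tval j env m) \<in> E"
  by (simp add: Adj_def holds_graph_def)

lemma sat_Touch:
  "holds_graph n E m \<Longrightarrow> tval i env m < n \<Longrightarrow> tval j env m < n \<Longrightarrow>
    sat (Touch i j) env m \<longleftrightarrow> touch E (m ''lev'') (tval i env m) (tval j env m)"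
  by (auto simp: Touch_def Same_def touch_def sat_Adj)

lemma sat_InS: "tval i env m < n \<Longrightarrow> sat (InS i) env m \<longleftrightarrow> tval i env m \<in> S_set n m"
  by (simp add: InS_def S_set_def)

lemma sat_Same: "sat (Same a i j) env m \<longleftrightarrow> m a (tval i env m) = m a (tval j env m)"
  by (simp add: Same_def)

definition row_loop :: loop where
  "row_loop = For (Assign ''row'' (Add (Var 0) (Lit 1)) (Add (Arr ''row'' (Var 0)) (Arr ''n'' (Lit 0))))"

lemma run_row_loop:
  assumes "m ''row'' 0 = 0"
  shows "v \<le> m ''n'' 0 \<Longrightarrow> run row_loop [] m ''row'' v = v * m ''n'' 0"
proof -
  define P where "P = (\<lambda>i m'. m' ''n'' = m ''n'' \<and> (\<forall>v\<le>i. m' ''row'' v = v * m ''n'' 0))"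
  have "P (m ''n'' 0) (run row_loop [] m)"
    unfolding row_loop_def
    by (rule run_For_invariant) (use assms in \<open>auto simp: P_def le_Suc_eq\<close>)
  then show "v \<le> m ''n'' 0 \<Longrightarrow> run row_loop [] m ''row'' v = v * m ''n'' 0" by (simp add: P_def)
qed

text \<open>\<open>Var 0\<close> is the round, \<open>Var 1\<close> the center, and
  \<open>Var 2\<close> to \<open>Var 8\<close> are its neighbors. Their number is fixed, so trying
  all choices remains polynomial.\<close>

definition Star :: fm where
  "Star = (Exists ^^ 7) (Conjs (concat (map (\<lambda>j.
     [Neg (Less (Arr ''lev'' (Var j)) (Var 0)), Adj (Var 1) (Var j)] @
     concat (map (\<lambda>i. [Neg (Equal (Var i) (Var j)), Neg (Adj (Var i) (Var j))]) [2..<j])) [2..<9])))"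

lemma sat_Star:
  assumes G: "holds_graph n E m" and v: "v < n" and sym: "\<And>u v. (u, v) \<in> E \<Longrightarrow> (v, u) \<in> E"
  shows "sat Star [k, v] m \<longleftrightarrow>
    (\<exists>U \<subseteq> {u. u < n \<and> k \<le> m ''lev'' u}. card U = 7 \<and> stable_set E U \<and> U \<subseteq> E `` {v})"
proof -
  have blocks: "(\<forall>\<phi>\<in>set (concat (map (\<lambda>j. A j @ concat (map (\<lambda>i. B i j) [2..<j])) [2..<h])). P \<phi>) \<longleftrightarrow>
      (\<forall>j\<in>{2..<h}. (\<forall>\<phi>\<in>set (A j). P \<phi>) \<and> (\<forall>i\<in>{2..<j}. \<forall>\<phi>\<in>set (B i j). P \<phi>))"
    for A :: "nat \<Rightarrow> fm list" and B h P
    by (auto simp: ball_Un)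
  have "sat Star [k, v] m \<longleftrightarrow> (\<exists>us. length us = 7 \<and> set us \<subseteq> {..<n} \<and>
     (\<forall>j\<in>{2..<9}. (k \<le> m ''lev'' (([k, v] @ us) ! j) \<and> sat (Adj (Var 1) (Var j)) ([k, v] @ us) m) \<and>
       (\<forall>i\<in>{2..<j}. ([k, v] @ us) ! i \<noteq> ([k, v] @ us) ! j \<and> \<not> sat (Adj (Var i) (Var j)) ([k, v] @ us) m)))"
    unfolding Star_def sat_Exists_funpow holds_graph_n[OF G] sat_Conjs blocks
    by (intro arg_cong[where f = Ex] ext conj_cong refl ball_cong) (auto simp: not_less)
  also have "\<dots> \<longleftrightarrow> (\<exists>us. length us = 7 \<and> set us \<subseteq> {..<n} \<and>
     (\<forall>j<7. k \<le> m ''lev'' (us ! j) \<and> (v, us ! j) \<in> E \<and>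
       (\<forall>i<j. us ! i \<noteq> us ! j \<and> (us ! i, us ! j) \<notin> E)))"
  proof (intro arg_cong[where f = Ex] ext conj_cong refl)
    fix us assume us: "length us = 7" "set us \<subseteq> {..<n}"
    have nth: "us ! j < n" if "j < 7" for j using us that by (metis lessThan_iff nth_mem subsetD)
    \<comment> \<open>The variables 2 to 8 become the positions 0 to 6 of \<open>us\<close>.\<close>
    have shift': "(\<forall>i\<in>{2..<Suc (Suc j)}. Q i) \<longleftrightarrow> (\<forall>i<j. Q (Suc (Suc i)))" for Q j
    proof -
      have "{2..<Suc (Suc j)} = (\<lambda>i. Suc (Suc i)) ` {..<j}"
        using image_add_atLeastLessThan[of 2 0 j] by (simp add: lessThan_atLeast0 numeral_2_eq_2)
      then show ?thesis by auto
    qed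
    have shift: "(\<forall>j\<in>{2..<9}. Q j) \<longleftrightarrow> (\<forall>j<7. Q (Suc (Suc j)))" for Q
      using shift'[of 7] by simp
    show "(\<forall>j\<in>{2..<9}. (k \<le> m ''lev'' (([k, v] @ us) ! j) \<and> sat (Adj (Var 1) (Var j)) ([k, v] @ us) m) \<and>
       (\<forall>i\<in>{2..<j}. ([k, v] @ us) ! i \<noteq> ([k, v] @ us) ! j \<and> \<not> sat (Adj (Var i) (Var j)) ([k, v] @ us) m))
      \<longleftrightarrow> (\<forall>j<7. k \<le> m ''lev'' (us ! j) \<and> (v, us ! j) \<in> E \<and>
       (\<forall>i<j. us ! i \<noteq> us ! j \<and> (us ! i, us ! j) \<notin> E))"
      unfolding shift shift' using nth v by (auto simp: sat_Adj[OF G])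
  qed
  also have "\<dots> \<longleftrightarrow> (\<exists>U \<subseteq> {u. u < n \<and> k \<le> m ''lev'' u}. card U = 7 \<and> stable_set E U \<and> U \<subseteq> E `` {v})"
    (is "?L \<longleftrightarrow> ?R")
  proof
    assume ?L
    then obtain us where us: "length us = 7" "set us \<subseteq> {..<n}"
      and *: "\<And>j. j < 7 \<Longrightarrow> k \<le> m ''lev'' (us ! j) \<and> (v, us ! j) \<in> E"
      and **: "\<And>i j. j < 7 \<Longrightarrow> i < j \<Longrightarrow> us ! i \<noteq> us ! j \<and> (us ! i, us ! j) \<notin> E"
      by blast
    have "distinct us" unfolding distinct_conv_nth using ** us(1) by (metis nat_neq_iff)
    then have "card (set us) = 7" using us(1) distinct_card by fastforce
    moreover have "stable_set E (set us)"
      unfolding stable_set_def using ** us(1) sym by (metis in_set_conv_nth nat_neq_iff)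
    moreover have "set us \<subseteq> {u. u < n \<and> k \<le> m ''lev'' u}" "set us \<subseteq> E `` {v}"
      using us * by (auto simp: in_set_conv_nth)
    ultimately show ?R by blast
  next
    assume ?R
    then obtain U where U: "U \<subseteq> {u. u < n \<and> k \<le> m ''lev'' u}" "card U = 7" "stable_set E U" "U \<subseteq> E `` {v}"
      by blast
    then have "finite U" by (metis card.infinite zero_neq_numeral)
    then obtain us where us: "set us = U" "distinct us" using finite_distinct_list by blast
    then have len: "length us = 7" using U(2) distinct_card by fastforce
    have "us ! j \<in> U" if "j < 7" for j using us len that by (metis nth_mem)
    moreover have "us ! i \<noteq> us ! j" if "j < 7" "i < j" for i j
      using us(2) len that by (simp add: nth_eq_iff_index_eq)
    ultimately show ?L
      using len us U by (intro exI[of _ us]) (auto simp: stable_set_def subset_iff)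
  qed
  finally show ?thesis .
qed

subsection \<open>The algorithm\<close>

text \<open>Updating in place is harmless: round \<open>i\<close> asks only which levels are at
  least \<open>i\<close>, and raising a level from \<open>i\<close> to \<open>i + 1\<close> does not
  change the answer. Vertices treated late in a round still see the core from its beginning.\<close>

definition lev_loop :: loop where
  "lev_loop = For (For (When (Conj (Neg (Less (Arr ''lev'' (Var 1)) (Var 0))) Star)
     (Assign ''lev'' (Var 1) (Add (Var 0) (Lit 1)))))"

lemma run_lev_loop:
  assumes G: "holds_graph n E m" and sym: "\<And>u v. (u, v) \<in> E \<Longrightarrow> (v, u) \<in> E"
    and lev0: "\<And>v. m ''lev'' v = 0"
  shows "v < n \<Longrightarrow> k \<le> n \<Longrightarrow> k \<le> run lev_loop [] m ''lev'' v \<longleftrightarrow> v \<in> core {..<n} E k"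
proof -
  let ?body = "When (Conj (Neg (Less (Arr ''lev'' (Var 1)) (Var 0))) Star)
     (Assign ''lev'' (Var 1) (Add (Var 0) (Lit 1)))"
  define P where "P = (\<lambda>i m'. holds_graph n E m' \<and>
    (\<forall>v<n. m' ''lev'' v \<le> i \<and> (\<forall>k\<le>i. k \<le> m' ''lev'' v \<longleftrightarrow> v \<in> core {..<n} E k)))"
  have "P n (run lev_loop [] m)"
    unfolding lev_loop_def
  proof (rule run_For_invariant)
    show "m ''n'' 0 = n" using holds_graph_n[OF G] .
    show "P 0 m" using G lev0 by (simp add: P_def)
    fix i m1 assume i: "i < n" and P: "P i m1"
    define P' where "P' = (\<lambda>j m'. holds_graph n E m' \<and>
      (\<forall>v<n. m' ''lev'' v \<le> (if v < j then Suc i else i) \<and>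
        (\<forall>k\<le>(if v < j then Suc i else i). k \<le> m' ''lev'' v \<longleftrightarrow> v \<in> core {..<n} E k)))"
    have "P' n (run (For ?body) ([] @ [i]) m1)"
    proof (rule run_For_invariant)
      show "m1 ''n'' 0 = n" using P by (auto simp: P_def dest: holds_graph_n)
      show "P' 0 m1" using P by (simp add: P_def P'_def)
      fix j m2 assume j: "j < n" and P': "P' j m2"
      have G2: "holds_graph n E m2" using P' by (simp add: P'_def)
      have ge_i: "i \<le> m2 ''lev'' v \<longleftrightarrow> v \<in> core {..<n} E i" if "v < n" for v
      proof -
        have "i \<le> (if v < j then Suc i else i)" by simp
        then show ?thesis using P' that unfolding P'_def by blast
      qed
      then have set: "{u. u < n \<and> i \<le> m2 ''lev'' u} = core {..<n} E i"
        using core_subset[of "{..<n}" E i] by auto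
      have lev_j: "m2 ''lev'' j \<le> i" "\<And>k. k \<le> i \<Longrightarrow> k \<le> m2 ''lev'' j \<longleftrightarrow> j \<in> core {..<n} E k"
        using P' j by (auto simp: P'_def)
      let ?m3 = "run ?body (([] @ [i]) @ [j]) m2"
      have sat: "sat (Conj (Neg (Less (Arr ''lev'' (Var 1)) (Var 0))) Star) [i, j] m2 \<longleftrightarrow>
          j \<in> core {..<n} E (Suc i)"
        using sat_Star[OF G2 j sym, of i] ge_i[OF j] unfolding set by auto
      have m3: "?m3 = (if j \<in> core {..<n} E (Suc i) then m2(''lev'' := (m2 ''lev'')(j := Suc i)) else m2)"
        using sat by (simp del: core.simps)
      have G3: "holds_graph n E ?m3" unfolding m3 using G2 by (auto intro: holds_graph_cong)
      have j_case: "?m3 ''lev'' j \<le> Suc i \<and> (\<forall>k\<le>Suc i. k \<le> ?m3 ''lev'' j \<longleftrightarrow> j \<in> core {..<n} E k)"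
      proof (cases "j \<in> core {..<n} E (Suc i)")
        case True
        then have "j \<in> core {..<n} E i" by simp
        then have "i \<le> m2 ''lev'' j" using ge_i j by simp
        then have "j \<in> core {..<n} E k" if "k \<le> i" for k using lev_j(2)[OF that] that by linarith
        then show ?thesis unfolding m3 using True by (auto simp: le_Suc_eq simp del: core.simps)
      next
        case False
        then show ?thesis unfolding m3 using lev_j by (auto simp: le_Suc_eq simp del: core.simps)
      qed
      have other: "?m3 ''lev'' v = m2 ''lev'' v" if "v \<noteq> j" for v unfolding m3 using that by simp
      show "P' (Suc j) ?m3"
        unfolding P'_def
      proof (intro conjI allI impI G3, goal_cases)
        case (1 v)
        then show ?case using P' j_case other[of v] by (cases "v = j") (auto simp: P'_def)
      next
        case (2 v k)
        then show ?case
          using P' j_case other[of v] by (cases "v = j") (auto simp: P'_def less_Suc_eq split: if_splits)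
      qed
    qed
    then show "P (Suc i) (run (For ?body) ([] @ [i]) m1)" by (simp add: P_def P'_def)
  qed
  then show "v < n \<Longrightarrow> k \<le> n \<Longrightarrow> k \<le> run lev_loop [] m ''lev'' v \<longleftrightarrow> v \<in> core {..<n} E k"
    by (simp add: P_def)
qed

section \<open>Local search for the independent set\<close>

definition Improving :: fm where
  "Improving = Conjs [Neg (InS (Var 2)), Neg (InS (Var 3)), Neg (Conj (Equal (Var 2) (Var 3)) (InS (Var 1))),
     Neg (Conj (Neg (Equal (Var 2) (Var 3))) (Touch (Var 2) (Var 3))),
     Neg (Exists (Conjs [InS (Var 4), Neg (Equal (Var 4) (Var 1)),
       Disj (Touch (Var 4) (Var 2)) (Touch (Var 4) (Var 3))]))]"

lemma sat_Improving:
  assumes G: "holds_graph n E m" and "s < n" "u < n" "w < n"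
  shows "sat Improving [i, s, u, w] m \<longleftrightarrow> improving E (m ''lev'') (S_set n m) s u w"
proof -
  have sub: "x < n" if "x \<in> S_set n m" for x using that by (simp add: S_set_def)
  have inner: "sat (Conjs [InS (Var 4), Neg (Equal (Var 4) (Var 1)),
       Disj (Touch (Var 4) (Var 2)) (Touch (Var 4) (Var 3))]) [i, s, u, w, x] m \<longleftrightarrow>
     x \<in> S_set n m \<and> x \<noteq> s \<and> (touch E (m ''lev'') x u \<or> touch E (m ''lev'') x w)" if "x < n" for x
    using that assms(2-4) by (simp add: sat_Touch[OF G] sat_InS[where n = n])
  have "sat (Exists (Conjs [InS (Var 4), Neg (Equal (Var 4) (Var 1)),
       Disj (Touch (Var 4) (Var 2)) (Touch (Var 4) (Var 3))])) [i, s, u, w] m \<longleftrightarrow>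
     (\<exists>x\<in>S_set n m. x \<noteq> s \<and> (touch E (m ''lev'') x u \<or> touch E (m ''lev'') x w))"
    unfolding sat.simps(5) holds_graph_n[OF G] using inner sub
    by (auto simp del: sat_Conjs Conjs.simps)
  moreover have "sat (Touch (Var 2) (Var 3)) [i, s, u, w] m \<longleftrightarrow> touch E (m ''lev'') u w"
    "sat (InS (Var 1)) [i, s, u, w] m \<longleftrightarrow> s \<in> S_set n m"
    "sat (InS (Var 2)) [i, s, u, w] m \<longleftrightarrow> u \<in> S_set n m"
    "sat (InS (Var 3)) [i, s, u, w] m \<longleftrightarrow> w \<in> S_set n m"
    using assms(2-4) by (simp_all add: sat_Touch[OF G] sat_InS[where n = n])
  ultimately show ?thesis
    unfolding Improving_def improving_def by (auto simp del: sat.simps(5) Conjs.simps)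
qed

text \<open>The outermost loop counts sweeps; each move enlarges \<open>S\<close>, so
  \<open>n\<close> sweeps suffice. Cell \<open>s\<close> is cleared before \<open>u\<close> and
  \<open>w\<close> are set, because \<open>s\<close> may equal \<open>u\<close> or \<open>w\<close>
  when it lies outside \<open>S\<close>.\<close>

definition search_loop :: loop where
  "search_loop = For (For (For (For (When Improving
     (Then (Assign ''S'' (Var 1) (Lit 0)) (Then (Assign ''S'' (Var 2) (Lit 1)) (Assign ''S'' (Var 3) (Lit 1))))))))"

lemma run_search_loop:
  assumes G: "holds_graph n E m" and S0: "\<And>v. m ''S'' v = 0"
    and sym: "\<And>u v. (u, v) \<in> E \<Longrightarrow> (v, u) \<in> E" and irrefl: "\<And>v. (v, v) \<notin> E"
  defines "S \<equiv> S_set n (run search_loop [] m)" and "lev \<equiv> m ''lev''"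
  shows "\<And>s t. s \<in> S \<Longrightarrow> t \<in> S \<Longrightarrow> lev s = lev t \<Longrightarrow> (s, t) \<notin> E"
    and "\<And>s u w. s < n \<Longrightarrow> u < n \<Longrightarrow> w < n \<Longrightarrow> \<not> improving E lev S s u w"
proof -
  define Inv where "Inv = (\<lambda>m'. holds_graph n E m' \<and> m' ''lev'' = lev \<and>
    (\<forall>s\<in>S_set n m'. \<forall>t\<in>S_set n m'. lev s = lev t \<longrightarrow> (s, t) \<notin> E))"
  define \<Phi> where "\<Phi> = (\<lambda>m'. n - card (S_set n m'))"
  have S_sub: "S_set n m' \<subseteq> {..<n}" for m' by (auto simp: S_set_def)
  let ?asg = "Then (Assign ''S'' (Var 1) (Lit 0)) (Then (Assign ''S'' (Var 2) (Lit 1)) (Assign ''S'' (Var 3) (Lit 1)))"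
  have body: "sweep (When Improving ?asg) [i, s, u, w] Inv \<Phi> (\<lambda>m'. \<not> improving E lev (S_set n m') s u w)"
    if "s < n" "u < n" "w < n" for i s u w
    unfolding sweep_def
  proof (intro allI impI)
    fix m' assume m': "Inv m'"
    let ?m'' = "run (When Improving ?asg) [i, s, u, w] m'"
    let ?S = "S_set n m'"
    have G': "holds_graph n E m'" and lev: "m' ''lev'' = lev" using m' by (auto simp: Inv_def)
    show "Inv ?m'' \<and> (if \<not> improving E lev ?S s u w then ?m'' = m' else \<Phi> ?m'' < \<Phi> m')"
    proof (cases "improving E lev ?S s u w")
      case False
      then have "?m'' = m'" using sat_Improving[OF G' that] lev by simp
      then show ?thesis using m' False by simp
    next
      case True
      then have m'': "?m'' = m'(''S'' := ((m' ''S'')(s := 0))(u := 1, w := 1))"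
        using sat_Improving[OF G' that] lev by simp
      have S'': "S_set n ?m'' = ?S - {s} \<union> {u, w}"
        unfolding m'' using that by (auto simp: S_set_def)
      have fin: "finite ?S" using S_sub finite_subset by blast
      have imp: "u \<notin> ?S" "w \<notin> ?S" "u = w \<Longrightarrow> s \<notin> ?S" "u \<noteq> w \<Longrightarrow> \<not> touch E lev u w"
        "\<And>x. x \<in> ?S \<Longrightarrow> x \<noteq> s \<Longrightarrow> \<not> touch E lev x u \<and> \<not> touch E lev x w"
        using True by (auto simp: improving_def)
      have "\<forall>a\<in>S_set n ?m''. \<forall>b\<in>S_set n ?m''. lev a = lev b \<longrightarrow> (a, b) \<notin> E"
        unfolding S'' using m' imp(4,5) sym irrefl by (fastforce simp: Inv_def touch_def)
      moreover have "holds_graph n E ?m''" "?m'' ''lev'' = lev"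
        unfolding m'' using G' lev by (auto intro: holds_graph_cong)
      ultimately have "Inv ?m''" by (simp add: Inv_def)
      moreover have "card ?S < card (S_set n ?m'')"
      proof (cases "s \<in> ?S")
        case s: True
        then have "u \<noteq> w" using imp by blast
        have "card (S_set n ?m'') = card (insert u (insert w (?S - {s})))" unfolding S'' by (simp add: insert_commute)
        also have "\<dots> = Suc (Suc (card (?S - {s})))" using imp fin \<open>u \<noteq> w\<close> by simp
        also have "\<dots> = Suc (card ?S)" using s fin by (metis card_Suc_Diff1)
        finally show ?thesis by simp
      next
        case False
        then have "?S \<subset> S_set n ?m''" unfolding S'' using imp by auto
        moreover have "finite (S_set n ?m'')" using S_sub finite_subset by blast
        ultimately show ?thesis by (rule psubset_card_mono[rotated])
      qed
      moreover have "card (S_set n ?m'') \<le> n"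
        using card_mono[OF _ S_sub, of ?m''] by simp
      ultimately show ?thesis using True by (simp add: \<Phi>_def)
    qed
  qed
  let ?Q = "\<lambda>m'. \<forall>s<n. \<forall>u<n. \<forall>w<n. \<not> improving E lev (S_set n m') s u w"
  have n: "\<And>m'. Inv m' \<Longrightarrow> m' ''n'' 0 = n" by (auto simp: Inv_def dest: holds_graph_n)
  have "sweep (For (For (For (When Improving ?asg)))) [i] Inv \<Phi> ?Q" for i
    by (intro sweep_For n) (simp_all add: body del: One_nat_def)
  then have "rounds search_loop [] Inv \<Phi> (n * 1) ?Q"
    unfolding search_loop_def by (intro rounds_For n sweep_imp_rounds) simp_all
  moreover have "Inv m" using G S0 by (simp add: Inv_def lev_def S_set_def)
  moreover have "\<Phi> m \<le> n * 1" by (simp add: \<Phi>_def)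
  \<comment> \<open>Potential 0 means that \<open>S\<close> contains every vertex, and then no
    vertex is left to be added.\<close>
  moreover have "?Q m'" if "Inv m'" "\<Phi> m' = 0" for m'
  proof -
    have "card (S_set n m') = n"
      using that(2) card_mono[OF _ S_sub, of m'] by (simp add: \<Phi>_def)
    then have "S_set n m' = {..<n}" using card_subset_eq[OF _ S_sub, of m'] by simp
    then show ?thesis by (simp add: improving_def)
  qed
  ultimately have "Inv (run search_loop [] m)" "?Q (run search_loop [] m)"
    using rounds_reach[of search_loop "[]" Inv \<Phi> "n * 1" ?Q m] by blast+
  then show "\<And>s t. s \<in> S \<Longrightarrow> t \<in> S \<Longrightarrow> lev s = lev t \<Longrightarrow> (s, t) \<notin> E"
    and "\<And>s u w. s < n \<Longrightarrow> u < n \<Longrightarrow> w < n \<Longrightarrow> \<not> improving E lev S s u w"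
    by (auto simp: Inv_def S_def)
qed

section \<open>Greedy coloring of the independent set\<close>

definition Linked :: fm where
  "Linked = Exists (Exists (Conjs [Touch (Var 0) (Var 3), Touch (Var 3) (Var 4), Touch (Var 4) (Var 2)]))"

lemma sat_Linked:
  assumes G: "holds_graph n E m" and "s < n" "t < n"
  shows "sat Linked [s, c, t] m \<longleftrightarrow> linked {..<n} E (m ''lev'') s t"
proof -
  have "sat (Conjs [Touch (Var 0) (Var 3), Touch (Var 3) (Var 4), Touch (Var 4) (Var 2)]) [s, c, t, x, y] m \<longleftrightarrow>
      touch E (m ''lev'') s x \<and> touch E (m ''lev'') x y \<and> touch E (m ''lev'') y t" if "x < n" "y < n" for x y
    using that assms(2,3) by (simp add: sat_Touch[OF G])
  then show ?thesis
    unfolding Linked_def linked_def sat.simps(5) holds_graph_n[OF G] append.simps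
    by (auto simp del: sat_Conjs Conjs.simps)
qed

text \<open>First fit in the order of vertex numbers. The inner variable merely counts attempts:
  fewer than \<open>n\<close> members precede \<open>s\<close>, so \<open>n\<close> attempts find a
  free color.\<close>

definition color_loop :: loop where
  "color_loop = For (For (When (Conj (InS (Var 0)) (Exists (Conjs
     [Less (Var 2) (Var 0), InS (Var 2), Linked, Same ''kap'' (Var 2) (Var 0)])))
     (Assign ''kap'' (Var 0) (Add (Arr ''kap'' (Var 0)) (Lit 1)))))"

lemma run_color_loop:
  assumes G: "holds_graph n E m" and kap0: "\<And>v. m ''kap'' v = 0"
  defines "S \<equiv> S_set n m" and "lev \<equiv> m ''lev''" and "kap \<equiv> run color_loop [] m ''kap''"
  assumes bound: "\<And>s. s \<in> S \<Longrightarrow> card {t \<in> S. t \<noteq> s \<and> linked {..<n} E lev s t} \<le> D"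
  shows "\<And>s. s \<in> S \<Longrightarrow> kap s \<le> D"
    and "\<And>s t. s \<in> S \<Longrightarrow> t \<in> S \<Longrightarrow> t < s \<Longrightarrow> linked {..<n} E lev s t \<Longrightarrow> kap s \<noteq> kap t"
proof -
  let ?\<phi> = "Conj (InS (Var 0)) (Exists (Conjs
     [Less (Var 2) (Var 0), InS (Var 2), Linked, Same ''kap'' (Var 2) (Var 0)]))"
  let ?body = "When ?\<phi> (Assign ''kap'' (Var 0) (Add (Arr ''kap'' (Var 0)) (Lit 1)))"
  define N where "N = (\<lambda>s. {t \<in> S. t < s \<and> linked {..<n} E lev s t})"
  have fin: "finite (N s)" for s by (simp add: N_def S_def S_set_def)
  have card_N: "card (N s) \<le> D" if "s \<in> S" for s
  proof -
    have "card (N s) \<le> card {t \<in> S. t \<noteq> s \<and> linked {..<n} E lev s t}"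
      by (intro card_mono) (auto simp: N_def S_def S_set_def)
    then show ?thesis using bound[OF that] by simp
  qed
  have card_N_less: "card (N s) < n" if "s < n" for s
  proof -
    have "card (N s) \<le> card {..<s}" by (intro card_mono) (auto simp: N_def)
    then show ?thesis using that by simp
  qed
  have body: "run ?body [s, c] m' = (if s \<in> S \<and> m' ''kap'' s \<in> m' ''kap'' ` N s
      then m'(''kap'' := (m' ''kap'')(s := Suc (m' ''kap'' s))) else m')"
    if same: "\<forall>b. b \<noteq> ''kap'' \<longrightarrow> m' b = m b" and s: "s < n" for m' s c
  proof -
    have G': "holds_graph n E m'" using G same by (auto intro: holds_graph_cong)
    have S': "S_set n m' = S" using same by (simp add: S_set_def S_def)
    have inner: "sat (Conjs [Less (Var 2) (Var 0), InS (Var 2), Linked, Same ''kap'' (Var 2) (Var 0)]) [s, c, t] m' \<longleftrightarrow>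
        t \<in> N s \<and> m' ''kap'' s = m' ''kap'' t" if "t < n" for t
      using that s sat_Linked[OF G' s that, of c] sat_InS[of "Var 2" "[s, c, t]" m' n] same
      by (auto simp: N_def S' sat_Same lev_def)
    have sub: "t < n" if "t \<in> N s" for t using that by (simp add: N_def S_def S_set_def)
    have "sat (Exists (Conjs [Less (Var 2) (Var 0), InS (Var 2), Linked,
        Same ''kap'' (Var 2) (Var 0)])) [s, c] m' \<longleftrightarrow> m' ''kap'' s \<in> m' ''kap'' ` N s"
      unfolding sat.simps(5) holds_graph_n[OF G'] append.simps image_iff
      using inner sub by (auto simp del: sat_Conjs Conjs.simps)
    moreover have "sat (InS (Var 0)) [s, c] m' \<longleftrightarrow> s \<in> S"
      using s sat_InS[of "Var 0" "[s, c]" m' n] S' by simp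
    ultimately have "sat ?\<phi> [s, c] m' \<longleftrightarrow> s \<in> S \<and> m' ''kap'' s \<in> m' ''kap'' ` N s"
      by (simp only: sat.simps(4))
    then show ?thesis by simp
  qed
  define P where "P = (\<lambda>i m'. (\<forall>b. b \<noteq> ''kap'' \<longrightarrow> m' b = m b) \<and> (\<forall>v. i \<le> v \<longrightarrow> m' ''kap'' v = 0) \<and>
    (\<forall>s\<in>S. s < i \<longrightarrow> m' ''kap'' s \<le> D \<and> m' ''kap'' s \<notin> m' ''kap'' ` N s))"
  have "P n (run color_loop [] m)"
    unfolding color_loop_def
  proof (rule run_For_invariant)
    show "m ''n'' 0 = n" using holds_graph_n[OF G] .
    show "P 0 m" using kap0 by (simp add: P_def)
    fix s m1 assume s: "s < n" and P: "P s m1"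
    define U where "U = m1 ''kap'' ` N s"
    \<comment> \<open>All colors below the current one are taken. If the current one is taken as
      well, every attempt so far has raised it, so it equals \<open>c\<close>; at the end this would
      be \<open>n\<close>, more than there are earlier members.\<close>
    define P' where "P' = (\<lambda>c m'. (\<forall>b. b \<noteq> ''kap'' \<longrightarrow> m' b = m b) \<and>
      (\<forall>v. v \<noteq> s \<longrightarrow> m' ''kap'' v = m1 ''kap'' v) \<and>
      (if s \<in> S then {..<m' ''kap'' s} \<subseteq> U \<and> (m' ''kap'' s \<notin> U \<or> m' ''kap'' s = c) else True))"
    have "P' n (run (For ?body) ([] @ [s]) m1)"
    proof (rule run_For_invariant)
      show "m1 ''n'' 0 = n" using P holds_graph_n[OF G] by (simp add: P_def)
      show "P' 0 m1" using P by (simp add: P_def P'_def)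
      fix c m2 assume c: "c < n" and P': "P' c m2"
      have same: "\<forall>b. b \<noteq> ''kap'' \<longrightarrow> m2 b = m b" using P' by (simp add: P'_def)
      have "m2 ''kap'' ` N s = U"
        unfolding U_def using P' by (intro image_cong) (auto simp: P'_def N_def)
      then show "P' (Suc c) (run ?body (([] @ [s]) @ [c]) m2)"
        using body[OF same s, of c] P' by (auto simp: P'_def lessThan_Suc less_Suc_eq)
    qed
    moreover define m3 where "m3 = run (For ?body) ([] @ [s]) m1"
    ultimately have P': "P' n m3" by simp
    have imgN: "m3 ''kap'' ` N t = m1 ''kap'' ` N t" if "t \<le> s" for t
      using P' that by (intro image_cong) (auto simp: P'_def N_def)
    have "m3 ''kap'' s \<le> D \<and> m3 ''kap'' s \<notin> U" if sS: "s \<in> S"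
    proof -
      have U: "finite U" "card U \<le> card (N s)" unfolding U_def using fin card_image_le by auto
      have k: "{..<m3 ''kap'' s} \<subseteq> U" "m3 ''kap'' s \<notin> U \<or> m3 ''kap'' s = n"
        using P' sS by (auto simp: P'_def)
      then have "m3 ''kap'' s \<le> card U" using card_mono[OF U(1) k(1)] by simp
      then show ?thesis using k U(2) card_N[OF sS] card_N_less[OF s] by auto
    qed
    then show "P (Suc s) (run (For ?body) ([] @ [s]) m1)"
      unfolding m3_def[symmetric] using P P' imgN
      by (auto simp: P_def P'_def U_def less_Suc_eq)
  qed
  then show "\<And>s. s \<in> S \<Longrightarrow> kap s \<le> D"
    and "\<And>s t. s \<in> S \<Longrightarrow> t \<in> S \<Longrightarrow> t < s \<Longrightarrow> linked {..<n} E lev s t \<Longrightarrow> kap s \<noteq> kap t"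
    by (auto simp: P_def kap_def N_def S_def S_set_def)
qed

section \<open>Grouping by the extreme touched members\<close>

definition Member :: "nat \<Rightarrow> fm" where
  "Member j = Conj (InS (Var j)) (Touch (Var 0) (Var j))"

definition first_loop :: loop where
  "first_loop = For (For (When (Conj (Member 1) (Neg (Exists (Conj (Less (Var 2) (Var 1)) (Member 2)))))
     (Assign ''fs'' (Var 0) (Var 1))))"

definition last_loop :: loop where
  "last_loop = For (For (When (Conj (Member 1) (Neg (Exists (Conj (Less (Var 1) (Var 2)) (Member 2)))))
     (Assign ''ls'' (Var 0) (Var 1))))"

lemma sat_Member:
  assumes "holds_graph n E m" "env ! 0 < n" "env ! j < n"
  shows "sat (Member j) env m \<longleftrightarrow> env ! j \<in> {s \<in> S_set n m. touch E (m ''lev'') (env ! 0) s}"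
  using assms sat_Touch[of n E m "Var 0" env "Var j"] sat_InS[of "Var j" env m n]
  by (simp add: Member_def)

lemma run_first_loop:
  assumes G: "holds_graph n E m" and v: "v < n"
  defines "T \<equiv> {s \<in> S_set n m. touch E (m ''lev'') v s}"
  assumes ne: "T \<noteq> {}"
  shows "run first_loop [] m ''fs'' v = Min T"
proof -
  define T' where "T' = (\<lambda>v. {s \<in> S_set n m. touch E (m ''lev'') v s})"
  have fin: "finite (T' v)" and sub: "T' v \<subseteq> {..<n}" for v by (auto simp: T'_def S_set_def)
  have T: "T = T' v" by (simp add: T_def T'_def)
  have Min: "Min T \<in> T" using ne fin T by simp
  show ?thesis
    unfolding first_loop_def
  proof (rule run_select[where n = n and R = "\<lambda>v s. s \<in> T' v \<and> (\<forall>t\<in>T' v. \<not> t < s)"])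
    show "m ''n'' 0 = n" by (rule holds_graph_n[OF G])
    show "sat (Conj (Member 1) (Neg (Exists (Conj (Less (Var 2) (Var 1)) (Member 2))))) [v, s] m' \<longleftrightarrow>
        s \<in> T' v \<and> (\<forall>t\<in>T' v. \<not> t < s)"
      if same: "\<And>b. b \<noteq> ''fs'' \<Longrightarrow> m' b = m b" and "v < n" "s < n" for m' v s
    proof -
      have G': "holds_graph n E m'" using G same by (auto intro: holds_graph_cong)
      have "S_set n m' = S_set n m" "m' ''lev'' = m ''lev''" using same by (auto simp: S_set_def)
      then have "sat (Member 1) [v, s] m' \<longleftrightarrow> s \<in> T' v"
        and inner: "\<And>t. t < n \<Longrightarrow> sat (Member 2) [v, s, t] m' \<longleftrightarrow> t \<in> T' v"
        using sat_Member[OF G', of "[v, s]" 1] sat_Member[OF G', of "[v, s, _]" 2] \<open>v < n\<close> \<open>s < n\<close>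
        by (simp_all add: T'_def)
      moreover have "sat (Exists (Conj (Less (Var 2) (Var 1)) (Member 2))) [v, s] m' \<longleftrightarrow> (\<exists>t\<in>T' v. t < s)"
        unfolding sat.simps(5) holds_graph_n[OF G'] append.simps using inner sub[of v] by auto
      ultimately show ?thesis by (simp only: sat.simps(3,4)) blast
    qed
    show "v < n" by (rule v)
    show "Min T < n" using Min sub T by auto
    show "Min T \<in> T' v \<and> (\<forall>t\<in>T' v. \<not> t < Min T)" using Min fin T by (auto simp: not_less)
  qed (auto simp: not_less intro: antisym)
qed

lemma run_last_loop:
  assumes G: "holds_graph n E m" and v: "v < n"
  defines "T \<equiv> {s \<in> S_set n m. touch E (m ''lev'') v s}"
  assumes ne: "T \<noteq> {}"
  shows "run last_loop [] m ''ls'' v = Max T"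
proof -
  define T' where "T' = (\<lambda>v. {s \<in> S_set n m. touch E (m ''lev'') v s})"
  have fin: "finite (T' v)" and sub: "T' v \<subseteq> {..<n}" for v by (auto simp: T'_def S_set_def)
  have T: "T = T' v" by (simp add: T_def T'_def)
  have Max: "Max T \<in> T" using ne fin T by simp
  show ?thesis
    unfolding last_loop_def
  proof (rule run_select[where n = n and R = "\<lambda>v s. s \<in> T' v \<and> (\<forall>t\<in>T' v. \<not> s < t)"])
    show "m ''n'' 0 = n" by (rule holds_graph_n[OF G])
    show "sat (Conj (Member 1) (Neg (Exists (Conj (Less (Var 1) (Var 2)) (Member 2))))) [v, s] m' \<longleftrightarrow>
        s \<in> T' v \<and> (\<forall>t\<in>T' v. \<not> s < t)"
      if same: "\<And>b. b \<noteq> ''ls'' \<Longrightarrow> m' b = m b" and "v < n" "s < n" for m' v s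
    proof -
      have G': "holds_graph n E m'" using G same by (auto intro: holds_graph_cong)
      have "S_set n m' = S_set n m" "m' ''lev'' = m ''lev''" using same by (auto simp: S_set_def)
      then have "sat (Member 1) [v, s] m' \<longleftrightarrow> s \<in> T' v"
        and inner: "\<And>t. t < n \<Longrightarrow> sat (Member 2) [v, s, t] m' \<longleftrightarrow> t \<in> T' v"
        using sat_Member[OF G', of "[v, s]" 1] sat_Member[OF G', of "[v, s, _]" 2] \<open>v < n\<close> \<open>s < n\<close>
        by (simp_all add: T'_def)
      moreover have "sat (Exists (Conj (Less (Var 1) (Var 2)) (Member 2))) [v, s] m' \<longleftrightarrow> (\<exists>t\<in>T' v. s < t)"
        unfolding sat.simps(5) holds_graph_n[OF G'] append.simps using inner sub[of v] by auto
      ultimately show ?thesis by (simp only: sat.simps(3,4)) blast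
    qed
    show "v < n" by (rule v)
    show "Max T < n" using Max sub T by auto
    show "Max T \<in> T' v \<and> (\<forall>t\<in>T' v. \<not> Max T < t)" using Max fin T by (auto simp: not_less)
  qed (auto simp: not_less intro: antisym)
qed

section \<open>Two-coloring the conflicts\<close>

definition Conflict :: fm where
  "Conflict = Conjs [Neg (Equal (Var 2) (Var 3)), Neg (Adj (Var 2) (Var 3)), Same ''lev'' (Var 2) (Var 3),
     Same ''fs'' (Var 2) (Var 3), Same ''ls'' (Var 2) (Var 3)]"

lemma sat_Conflict:
  "holds_graph n E m \<Longrightarrow> u < n \<Longrightarrow> w < n \<Longrightarrow>
    sat Conflict [i, j, u, w] m \<longleftrightarrow> conflict E (m ''lev'') (m ''fs'') (m ''ls'') u w"
  using sat_Adj[of n E m "Var 2" "[i, j, u, w]" "Var 3"] by (auto simp: Conflict_def conflict_def sat_Same)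

definition init_loop :: loop where
  "init_loop = For (Assign ''rt'' (Var 0) (Var 0))"

text \<open>Smaller labels spread along conflicts, flipping the parity at each step. The two outer
  loops count \<open>n * n\<close> sweeps; this is enough, as a sweep that changes anything lowers
  the sum of the labels.\<close>

definition parity_loop :: loop where
  "parity_loop = For (For (For (For (When (Conj Conflict (Less (Arr ''rt'' (Var 2)) (Arr ''rt'' (Var 3))))
     (Then (Assign ''rt'' (Var 3) (Arr ''rt'' (Var 2)))
       (Assign ''par'' (Var 3) (Sub (Lit 1) (Arr ''par'' (Var 2)))))))))"

lemma run_init_loop: "v < m ''n'' 0 \<Longrightarrow> run init_loop [] m ''rt'' v = v"
proof -
  define P where "P = (\<lambda>(i :: nat) (m' :: memory). \<forall>v<i. m' ''rt'' v = v)"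
  have "P (m ''n'' 0) (run init_loop [] m)"
    unfolding init_loop_def
    by (rule run_For_invariant) (auto simp: P_def less_Suc_eq)
  then show "v < m ''n'' 0 \<Longrightarrow> run init_loop [] m ''rt'' v = v" by (simp add: P_def)
qed

text \<open>The label \<open>rt v\<close> is a vertex connected to \<open>v\<close> by conflicts, and \<open>par v\<close> is the parity of the
  connection. When the labels have settled, they agree along each conflict, so that the parities
  differ.\<close>

lemma run_parity_loop:
  assumes G: "holds_graph n E m" and par0: "\<And>v. m ''par'' v = 0" and rt0: "\<And>v. v < n \<Longrightarrow> m ''rt'' v = v"
    and sym: "\<And>u v. (u, v) \<in> E \<Longrightarrow> (v, u) \<in> E"
  defines "C \<equiv> conflict E (m ''lev'') (m ''fs'') (m ''ls'')" and "par \<equiv> run parity_loop [] m ''par''"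
  assumes f: "\<And>u w. u < n \<Longrightarrow> w < n \<Longrightarrow> C u w \<Longrightarrow> f u \<noteq> (f w :: bool)"
  shows "\<And>v. v < n \<Longrightarrow> par v \<le> 1"
    and "\<And>u w. u < n \<Longrightarrow> w < n \<Longrightarrow> C u w \<Longrightarrow> par u \<noteq> par w"
proof -
  \<comment> \<open>The two-coloring \<open>f\<close> is known to exist but unknown to the program.
    It determines \<open>par v\<close> as telling whether \<open>f\<close> separates
    \<open>v\<close> from \<open>rt v\<close>, no matter along which conflicts the label has
    travelled.\<close>
  define Inv where "Inv = (\<lambda>m'. (\<forall>a. a \<noteq> ''rt'' \<longrightarrow> a \<noteq> ''par'' \<longrightarrow> m' a = m a) \<and>
    (\<forall>v<n. m' ''rt'' v < n \<and> m' ''par'' v = (if f v = f (m' ''rt'' v) then 0 else 1)))"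
  define \<Phi> where "\<Phi> = (\<lambda>m' :: memory. \<Sum>v<n. m' ''rt'' v)"
  let ?asg = "Then (Assign ''rt'' (Var 3) (Arr ''rt'' (Var 2)))
       (Assign ''par'' (Var 3) (Sub (Lit 1) (Arr ''par'' (Var 2))))"
  let ?p = "When (Conj Conflict (Less (Arr ''rt'' (Var 2)) (Arr ''rt'' (Var 3)))) ?asg"
  have Inv_G: "holds_graph n E m'" if "Inv m'" for m'
    by (rule holds_graph_cong[OF G]) (use that in \<open>simp_all add: Inv_def\<close>)
  have body: "sweep ?p [i, j, u, w] Inv \<Phi> (\<lambda>m'. \<not> (C u w \<and> m' ''rt'' u < m' ''rt'' w))"
    if uw: "u < n" "w < n" for i j u w
    unfolding sweep_def
  proof (intro allI impI)
    fix m' assume m': "Inv m'"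
    let ?m'' = "run ?p [i, j, u, w] m'"
    have sat: "sat (Conj Conflict (Less (Arr ''rt'' (Var 2)) (Arr ''rt'' (Var 3)))) [i, j, u, w] m' \<longleftrightarrow>
        C u w \<and> m' ''rt'' u < m' ''rt'' w"
      using sat_Conflict[OF Inv_G[OF m'] uw, of i j] m' by (simp add: C_def Inv_def)
    show "Inv ?m'' \<and> (if \<not> (C u w \<and> m' ''rt'' u < m' ''rt'' w) then ?m'' = m' else \<Phi> ?m'' < \<Phi> m')"
    proof (cases "C u w \<and> m' ''rt'' u < m' ''rt'' w")
      case False
      then have "?m'' = m'" by (simp only: run.simps(3) sat if_False)
      then show ?thesis using m' False by simp
    next
      case True
      then have m'': "?m'' = m'(''rt'' := (m' ''rt'')(w := m' ''rt'' u), ''par'' := (m' ''par'')(w := 1 - m' ''par'' u))"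
        by (simp only: run.simps(3) sat if_True simp_thms) simp
      have "f u \<noteq> f w" using f uw True by blast
      then have "Inv ?m''" unfolding m'' using m' uw by (auto simp: Inv_def)
      moreover have "\<Phi> ?m'' < \<Phi> m'"
        unfolding m'' \<Phi>_def by (rule sum_strict_mono_ex1) (use True uw in auto)
      ultimately show ?thesis using True by simp
    qed
  qed
  let ?Q = "\<lambda>m'. \<forall>u<n. \<forall>w<n. \<not> (C u w \<and> m' ''rt'' u < m' ''rt'' w)"
  have n: "\<And>m'. Inv m' \<Longrightarrow> m' ''n'' 0 = n" using Inv_G holds_graph_n by blast
  have "sweep (For (For ?p)) [i, j] Inv \<Phi> ?Q" for i j
    by (intro sweep_For n) (simp_all only: append.simps body)
  then have "rounds parity_loop [] Inv \<Phi> (n * (n * 1)) ?Q"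
    unfolding parity_loop_def by (intro rounds_For n sweep_imp_rounds) simp_all
  moreover have "Inv m" using rt0 par0 by (simp add: Inv_def)
  moreover have "\<Phi> m \<le> n * (n * 1)"
    using sum_bounded_above[of "{..<n}" "m ''rt''" n] rt0 by (simp add: \<Phi>_def)
  moreover have "?Q m'" if "Inv m'" "\<Phi> m' = 0" for m'
    using that(2) by (simp add: \<Phi>_def)
  ultimately have *: "Inv (run parity_loop [] m)" "?Q (run parity_loop [] m)"
    using rounds_reach[of parity_loop "[]" Inv \<Phi> "n * (n * 1)" ?Q m] by blast+
  then show "\<And>v. v < n \<Longrightarrow> par v \<le> 1" by (simp add: Inv_def par_def)
  show "par u \<noteq> par w" if uw: "u < n" "w < n" "C u w" for u w
  proof -
    have "C w u" using uw(3) sym by (auto simp: C_def conflict_def)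
    then have "run parity_loop [] m ''rt'' u = run parity_loop [] m ''rt'' w"
      using *(2) uw by (meson nat_neq_iff)
    then show ?thesis using *(1) f[OF uw] uw(1,2) by (auto simp: Inv_def par_def)
  qed
qed

section \<open>From tuples to colors\<close>

definition Same_class :: "nat \<Rightarrow> fm" where
  "Same_class j = Conjs [Same ''lev'' (Var 0) (Var j),
     Same ''kap'' (Arr ''fs'' (Var 0)) (Arr ''fs'' (Var j)),
     Same ''kap'' (Arr ''ls'' (Var 0)) (Arr ''ls'' (Var j)), Same ''par'' (Var 0) (Var j)]"

definition class_of :: "memory \<Rightarrow> nat \<Rightarrow> nat \<times> nat \<times> nat \<times> nat" where
  "class_of m v = (m ''lev'' v, m ''kap'' (m ''fs'' v), m ''kap'' (m ''ls'' v), m ''par'' v)"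

lemma sat_Same_class: "sat (Same_class j) env m \<longleftrightarrow> class_of m (env ! 0) = class_of m (env ! j)"
  by (simp add: Same_class_def class_of_def sat_Same)

text \<open>A cell of \<open>col\<close> holds a single number, so a tuple is encoded by the least
  vertex that has it.\<close>

definition output_loop :: loop where
  "output_loop = For (For (When (Conj (Same_class 1) (Neg (Exists (Conj (Less (Var 2) (Var 1)) (Same_class 2)))))
     (Assign ''col'' (Var 0) (Var 1))))"

lemma run_output_loop:
  assumes n: "m ''n'' 0 = n" and uv: "u < n" "v < n"
  shows "run output_loop [] m ''col'' u = run output_loop [] m ''col'' v \<longleftrightarrow> class_of m u = class_of m v"
proof -
  define T where "T = (\<lambda>v. {w. w < n \<and> class_of m v = class_of m w})"
  have fin: "finite (T v)" for v by (simp add: T_def)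
  have self: "v \<in> T v" if "v < n" for v using that by (simp add: T_def)
  have Min: "Min (T v) \<in> T v" if "v < n" for v using self[OF that] fin by (intro Min_in) auto
  have *: "run output_loop [] m ''col'' v = Min (T v)" if v: "v < n" for v
    unfolding output_loop_def
  proof (rule run_select[where n = n and R = "\<lambda>v s. s \<in> T v \<and> (\<forall>t\<in>T v. \<not> t < s)"])
    show "m ''n'' 0 = n" by (rule n)
    show "sat (Conj (Same_class 1) (Neg (Exists (Conj (Less (Var 2) (Var 1)) (Same_class 2))))) [v, s] m' \<longleftrightarrow>
        s \<in> T v \<and> (\<forall>t\<in>T v. \<not> t < s)"
      if same: "\<And>b. b \<noteq> ''col'' \<Longrightarrow> m' b = m b" and "v < n" "s < n" for m' v s
    proof -
      have "class_of m' = class_of m" "m' ''n'' 0 = n" using same n by (auto simp: class_of_def fun_eq_iff)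
      then show ?thesis using that(2,3) by (auto simp: sat_Same_class T_def) (metis less_trans)
    qed
    show "v < n" by (rule v)
    show "Min (T v) < n" using Min[OF v] by (simp add: T_def)
    show "Min (T v) \<in> T v \<and> (\<forall>t\<in>T v. \<not> t < Min (T v))" using Min[OF v] fin by (auto simp: not_less)
  qed (auto simp: not_less intro: antisym)
  show ?thesis
  proof
    assume "run output_loop [] m ''col'' u = run output_loop [] m ''col'' v"
    then have "Min (T u) = Min (T v)" using * uv by simp
    then show "class_of m u = class_of m v" using Min uv by (metis (mono_tags, lifting) T_def mem_Collect_eq)
  next
    assume "class_of m u = class_of m v"
    then have "T u = T v" by (simp add: T_def)
    then show "run output_loop [] m ''col'' u = run output_loop [] m ''col'' v" using * uv by simp
  qed
qed

section \<open>The approximation guarantee\<close>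

lemma core_less_subchromatic_number:
  assumes G: "delta_disk_graph G" and v: "v \<in> core (pverts G) (parcs G) k"
  shows "k < subchromatic_number G"
proof -
  obtain lo hi where "near_interval (pverts G) (parcs G) lo hi (ln 2)"
    by (rule delta_disk_graph_near_interval[OF G])
  then interpret near_interval "pverts G" "parcs G" lo hi "ln 2" .
  have pg: "pair_graph G" using G by (simp add: delta_disk_graph_def)
  have "\<exists>k \<P>. subcoloring G \<P> \<and> card \<P> = k" using subcoloring_singletons by blast
  then obtain \<P> where \<P>: "subcoloring G \<P>" "card \<P> = subchromatic_number G"
    unfolding subchromatic_number_def by (rule LeastI_ex[THEN exE]) blast
  then have part: "partition_on (pverts G) \<P>" and cliques: "\<And>X. X \<in> \<P> \<Longrightarrow> induces_disjoint_cliques G X"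
    by (auto simp: subcoloring_def)
  have "\<forall>v\<in>pverts G. \<exists>X. X \<in> \<P> \<and> v \<in> X" using partition_onD1[OF part] by blast
  \<comment> \<open>The classes of an optimal subcoloring themselves serve as colors.\<close>
  then obtain c where c: "\<And>v. v \<in> pverts G \<Longrightarrow> c v \<in> \<P> \<and> v \<in> c v" by metis
  have "k < card (c ` inside v)"
  proof (rule core_colors[OF _ v])
    fix x y z assume V: "x \<in> pverts G" "y \<in> pverts G" "z \<in> pverts G" and eq: "c x = c y" "c z = c y"
      and E: "(x, y) \<in> parcs G" "(y, z) \<in> parcs G" "x \<noteq> z"
    have "x \<in> c y" "y \<in> c y" "z \<in> c y" "c y \<in> \<P>" using c[OF V(1)] c[OF V(2)] c[OF V(3)] eq by auto
    then show "(x, z) \<in> parcs G"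
      using cliques[of "c y"] E unfolding induces_disjoint_cliques_iff_no_induced_P3[OF pg] by blast
  qed
  also have "c ` inside v \<subseteq> \<P>" using c by (auto simp: inside_def)
  then have "card (c ` inside v) \<le> card \<P>"
    using finite_elements[OF finite_V part] by (intro card_mono)
  finally show ?thesis using \<P>(2) by simp
qed

lemma subchromatic_number_le_order:
  assumes "finite (pverts G)"
  shows "subchromatic_number G \<le> order_of G"
proof -
  have "subchromatic_number G \<le> card (color_classes (pverts G) id)"
    unfolding subchromatic_number_def using subcoloring_singletons by (intro Least_le) blast
  also have "\<dots> \<le> card (pverts G)"
    unfolding color_classes_def by (rule card_image_le[OF assms])
  finally show ?thesis by (simp add: order_of_def)
qed

lemma holds_graph_run_row_loop:
  assumes "order_of G = n"
  shows "holds_graph n (parcs G) (run row_loop [] (graph_input G))"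
proof -
  let ?m = "graph_input G"
  have n: "?m ''n'' 0 = n" and row: "?m ''row'' 0 = 0" using assms by (auto simp: graph_input_def)
  have keep: "run row_loop [] ?m ''n'' = ?m ''n''" "run row_loop [] ?m ''adj'' = ?m ''adj''"
    by (simp_all add: run_unwritten row_loop_def del: run.simps)
  have "0 < ?m ''adj'' (u * n + v) \<longleftrightarrow> (u, v) \<in> parcs G" if "u < n" "v < n" for u v
  proof -
    have "u * n + v < Suc u * n" using that by simp
    also have "\<dots> \<le> n * n" using that by (intro mult_right_mono) auto
    finally show ?thesis using that assms by (simp add: graph_input_def)
  qed
  then show ?thesis
    unfolding holds_graph_def keep using n row run_row_loop[of ?m] by simp
qed

definition algorithm :: loop where
  "algorithm = Then row_loop (Then lev_loop (Then search_loop (Then color_loop (Then first_loop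
     (Then last_loop (Then init_loop (Then parity_loop output_loop)))))))"

lemma wf_algorithm: "wf_loop 0 algorithm"
  by (auto simp: algorithm_def row_loop_def lev_loop_def Star_def search_loop_def Improving_def
      color_loop_def Linked_def first_loop_def last_loop_def Member_def init_loop_def parity_loop_def
      Conflict_def output_loop_def Same_class_def Adj_def Same_def Touch_def InS_def)

lemma written_loops:
  "written row_loop = {''row''}" "written lev_loop = {''lev''}" "written search_loop = {''S''}"
  "written color_loop = {''kap''}" "written first_loop = {''fs''}" "written last_loop = {''ls''}"
  "written init_loop = {''rt''}" "written parity_loop = {''rt'', ''par''}" "written output_loop = {''col''}"
  by (auto simp: row_loop_def lev_loop_def search_loop_def color_loop_def first_loop_def last_loop_def
      init_loop_def parity_loop_def output_loop_def)

lemma algorithm_correct: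
  assumes G: "delta_disk_graph G" and V: "pverts G = {..<card (pverts G)}"
  defines "m \<equiv> run algorithm [] (graph_input G)"
  shows "subcoloring G (output_partition G m)"
    and "card (output_partition G m) \<le> 1458 * subchromatic_number G"
proof -
  define n where "n = order_of G"
  define E where "E = parcs G"
  have V: "pverts G = {..<n}" using V by (simp add: n_def order_of_def)
  have pg: "pair_graph G" using G by (simp add: delta_disk_graph_def)
  obtain lo hi where "near_interval (pverts G) (parcs G) lo hi (ln 2)"
    by (rule delta_disk_graph_near_interval[OF G])
  then interpret near_interval "{..<n}" E lo hi "ln 2" unfolding V E_def .
  define m0 where "m0 = graph_input G"
  define m1 where "m1 = run row_loop [] m0"
  define m2 where "m2 = run lev_loop [] m1"
  define m3 where "m3 = run search_loop [] m2"
  define m4 where "m4 = run color_loop [] m3"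
  define m5 where "m5 = run first_loop [] m4"
  define m6 where "m6 = run last_loop [] m5"
  define m7 where "m7 = run init_loop [] m6"
  define m8 where "m8 = run parity_loop [] m7"
  have m: "m = run output_loop [] m8"
    by (simp add: m_def algorithm_def m8_def m7_def m6_def m5_def m4_def m3_def m2_def m1_def m0_def)
  note frame = run_unwritten written_loops
  have f1: "m1 a = m0 a" if "a \<noteq> ''row''" for a using that by (simp add: m1_def frame)
  have f2: "m2 a = m1 a" if "a \<noteq> ''lev''" for a using that by (simp add: m2_def frame)
  have f3: "m3 a = m2 a" if "a \<noteq> ''S''" for a using that by (simp add: m3_def frame)
  have f4: "m4 a = m3 a" if "a \<noteq> ''kap''" for a using that by (simp add: m4_def frame)
  have f5: "m5 a = m4 a" if "a \<noteq> ''fs''" for a using that by (simp add: m5_def frame)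
  have f6: "m6 a = m5 a" if "a \<noteq> ''ls''" for a using that by (simp add: m6_def frame)
  have f7: "m7 a = m6 a" if "a \<noteq> ''rt''" for a using that by (simp add: m7_def frame)
  have f8: "m8 a = m7 a" if "a \<noteq> ''rt''" "a \<noteq> ''par''" for a using that by (simp add: m8_def frame)
  have zero: "m0 a v = 0" if "a \<noteq> ''n''" "a \<noteq> ''adj''" for a v using that by (simp add: m0_def graph_input_def)
  have G1: "holds_graph n E m1" unfolding m1_def m0_def E_def using n_def
    by (intro holds_graph_run_row_loop) simp
  have G2: "holds_graph n E m2" by (rule holds_graph_cong[OF G1]) (simp_all add: f2)
  have G3: "holds_graph n E m3" by (rule holds_graph_cong[OF G2]) (simp_all add: f3)
  have G4: "holds_graph n E m4" by (rule holds_graph_cong[OF G3]) (simp_all add: f4)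
  have G5: "holds_graph n E m5" by (rule holds_graph_cong[OF G4]) (simp_all add: f5)
  have G6: "holds_graph n E m6" by (rule holds_graph_cong[OF G5]) (simp_all add: f6)
  have G7: "holds_graph n E m7" by (rule holds_graph_cong[OF G6]) (simp_all add: f7)
  have G8: "holds_graph n E m8" by (rule holds_graph_cong[OF G7]) (simp_all add: f8)
  define lev where "lev = m2 ''lev''"
  define S where "S = S_set n m3"
  define kap where "kap = m4 ''kap''"
  define fs where "fs = m5 ''fs''"
  define ls where "ls = m6 ''ls''"
  define par where "par = m8 ''par''"
  have S_sub: "S \<subseteq> {..<n}" by (auto simp: S_def S_set_def)
  have core: "k \<le> lev v \<longleftrightarrow> v \<in> core {..<n} E k" if "v < n" "k \<le> n" for v k
    unfolding lev_def m2_def using that by (intro run_lev_loop G1) (auto simp: f1 zero intro: sym_E)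
  have core_sub: "k < subchromatic_number G" if "v \<in> core {..<n} E k" for v k
    using core_less_subchromatic_number[OF G, of v k] that by (simp add: V E_def)
  have sub_n: "subchromatic_number G \<le> n" unfolding n_def by (rule subchromatic_number_le_order) (simp add: V)
  \<comment> \<open>The levels determine the cores only up to index \<open>n\<close>, so strictness
    is needed to cover \<open>Suc (lev v)\<close>. A survivor of \<open>n\<close> rounds would force
    more than \<open>n\<close> colors, while singletons use only \<open>n\<close>.\<close>
  have lev_n: "lev v < n" if "v < n" for v
    using core[OF that, of n] core_sub[of v n] sub_n by auto
  have lev_core: "v \<in> core {..<n} E (lev v)" if "v < n" for v
    using core[OF that, of "lev v"] lev_n[OF that] by simp
  have lev_sub: "lev v < subchromatic_number G" if "v < n" for v
    using core_sub lev_core that by blast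
  have S_indep: "\<And>s t. s \<in> S \<Longrightarrow> t \<in> S \<Longrightarrow> lev s = lev t \<Longrightarrow> (s, t) \<notin> E"
    and S_opt: "\<And>s u w. s < n \<Longrightarrow> u < n \<Longrightarrow> w < n \<Longrightarrow> \<not> improving E lev S s u w"
    unfolding S_def lev_def m3_def
    using run_search_loop[OF G2 _ sym_E irrefl_E] by (auto simp: f1 f2 zero)
  interpret leveled_near_interval "{..<n}" E lo hi "ln 2" lev S
  proof
    fix v U assume v: "v \<in> {..<n}" and U: "U \<subseteq> {u \<in> {..<n}. lev u = lev v}" "stable_set E U" "U \<subseteq> E `` {v}"
    show "card U \<noteq> 7"
    proof
      \<comment> \<open>A star within one level would carry its center into the next core.\<close>
      assume "card U = 7"
      moreover have "U \<subseteq> core {..<n} E (lev v)" using U(1) lev_core by force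
      ultimately have "v \<in> core {..<n} E (Suc (lev v))" using U lev_core v by auto
      then show False using core[of v "Suc (lev v)"] lev_n[of v] v by (auto simp del: core.simps)
    qed
  qed (use S_sub S_indep in auto)
  have levs: "m3 ''lev'' = lev" "m4 ''lev'' = lev" "m5 ''lev'' = lev" "m6 ''lev'' = lev" "m7 ''lev'' = lev"
      "m8 ''lev'' = lev"
    by (simp_all add: lev_def f3 f4 f5 f6 f7 f8)
  have Ss: "S_set n m4 = S" "S_set n m5 = S" by (simp_all add: S_def S_set_def f4 f5)
  have kap_bound: "kap s \<le> 26" if "s \<in> S" for s
    unfolding kap_def m4_def using that card_linked
    by (intro run_color_loop(1)[OF G3]) (auto simp: f1 f2 f3 zero S_def levs)
  have kap_less: "kap s \<noteq> kap t" if "s \<in> S" "t \<in> S" "t < s" "linked {..<n} E lev s t" for s t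
    unfolding kap_def m4_def using that card_linked
    by (intro run_color_loop(2)[OF G3, of 26]) (auto simp: f1 f2 f3 zero S_def levs)
  have kap_neq: "s = t" if "s \<in> S" "t \<in> S" "linked {..<n} E lev s t" "kap s = kap t" for s t
  proof (rule ccontr)
    assume "s \<noteq> t"
    moreover have "linked {..<n} E lev t s" using that(3) touch_sym unfolding linked_def by blast
    ultimately show False using kap_less[of s t] kap_less[of t s] that by (auto simp: nat_neq_iff)
  qed
  define T where "T = (\<lambda>v. {s \<in> S. touch E lev v s})"
  have T_fin: "finite (T v)" for v using finite_S by (simp add: T_def)
  have T_ne: "T v \<noteq> {}" if "v < n" for v
  proof
    assume T: "T v = {}"
    then have "v \<notin> S" by (auto simp: T_def touch_def)
    moreover have "\<not> touch E lev x v" if "x \<in> S" for x using T that touch_sym by (auto simp: T_def)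
    \<comment> \<open>Adding just \<open>v\<close> is the move in which all three vertices
      coincide.\<close>
    ultimately have "improving E lev S v v v" by (simp add: improving_def)
    then show False using S_opt that by blast
  qed
  have fs_eq: "fs v = Min (T v)" if "v < n" for v
    using run_first_loop[OF G4 that] T_ne[OF that] by (simp add: T_def fs_def m5_def Ss levs)
  have ls_eq: "ls v = Max (T v)" if "v < n" for v
    using run_last_loop[OF G5 that] T_ne[OF that] by (simp add: T_def ls_def m6_def Ss levs)
  have fs_T: "fs v \<in> T v" and ls_T: "ls v \<in> T v" if "v < n" for v
    using Min_in[OF T_fin T_ne[OF that]] Max_in[OF T_fin T_ne[OF that]] that by (simp_all add: fs_eq ls_eq)
  interpret clustered_near_interval "{..<n}" E lo hi "ln 2" lev S fs ls
  proof
    fix v s assume v: "v \<in> {..<n}" "fs v = ls v" and s: "s \<in> S" "touch E lev v s"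
    then have "s \<in> T v" by (simp add: T_def)
    then have "fs v \<le> s" "s \<le> ls v"
      using v(1) Min_le[OF T_fin] Max_ge[OF T_fin] by (simp_all add: fs_eq ls_eq)
    then show "s = fs v" using v by simp
  qed (use S_opt fs_T ls_T in \<open>auto simp: T_def\<close>)
  obtain f where f: "\<And>u w. u \<in> {..<n} \<Longrightarrow> w \<in> {..<n} \<Longrightarrow> conflict E lev fs ls u w \<Longrightarrow> f u \<noteq> (f w :: bool)"
    by (rule conflict_bipartite) (rule that)
  have fsls: "m7 ''fs'' = fs" "m8 ''fs'' = fs" "m7 ''ls'' = ls" "m8 ''ls'' = ls" "m8 ''kap'' = kap"
    by (simp_all add: fs_def ls_def kap_def f5 f6 f7 f8)
  have rt: "m7 ''rt'' v = v" if "v < n" for v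
    unfolding m7_def using run_init_loop[of v m6] that holds_graph_n[OF G6] by simp
  have par0: "m7 ''par'' v = 0" for v by (simp add: f1 f2 f3 f4 f5 f6 f7 zero)
  have conf: "conflict E (m7 ''lev'') (m7 ''fs'') (m7 ''ls'') = conflict E lev fs ls" by (simp add: levs fsls)
  have par1: "par v \<le> 1" if "v < n" for v
    unfolding par_def m8_def using that
    by (rule run_parity_loop(1)[OF G7 par0 rt sym_E, where f = f, rotated -1]) (use f conf in auto)
  have par: "par u \<noteq> par w" if "u < n" "w < n" "conflict E lev fs ls u w" for u w
    unfolding par_def m8_def
    by (rule run_parity_loop(2)[OF G7 par0 rt sym_E, where f = f]) (use f conf that in auto)
  have cls: "class_of m8 v = (lev v, kap (fs v), kap (ls v), par v)" for v
    by (simp add: class_of_def levs fsls par_def)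
  have col: "m ''col'' u = m ''col'' v \<longleftrightarrow> class_of m8 u = class_of m8 v" if "u < n" "v < n" for u v
    unfolding m using holds_graph_n[OF G8] that by (rule run_output_loop)
  \<comment> \<open>If \<open>x\<close> touches \<open>v\<close>, then \<open>fs x\<close>,
    \<open>x\<close>, \<open>v\<close>, \<open>fs v\<close> form a walk, so equal \<open>kap\<close>
    forces \<open>fs x = fs v\<close>; likewise for \<open>ls\<close>. Thus \<open>u\<close> and
    \<open>w\<close> belong to one group, and there equal parities rule out a conflict.\<close>
  have clique: "(u, w) \<in> E"
    if V: "u < n" "v < n" "w < n" and "class_of m8 u = class_of m8 v" "class_of m8 w = class_of m8 v"
      and E: "(u, v) \<in> E" "(v, w) \<in> E" and "u \<noteq> w" for u v w
  proof (rule ccontr)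
    assume "(u, w) \<notin> E"
    have eq: "lev u = lev v" "lev w = lev v" "kap (fs u) = kap (fs v)" "kap (fs w) = kap (fs v)"
      "kap (ls u) = kap (ls v)" "kap (ls w) = kap (ls v)" "par u = par w"
      using that by (simp_all add: cls)
    have "touch E lev u v" "touch E lev w v" using eq E sym_E by (auto simp: touch_def)
    moreover have "fs x = fs v \<and> ls x = ls v"
      if x: "x < n" "touch E lev x v" "kap (fs x) = kap (fs v)" "kap (ls x) = kap (ls v)" for x
    proof -
      have xv: "x \<in> {..<n}" "v \<in> {..<n}" using x V by auto
      have "linked {..<n} E lev s t" if "touch E lev x s" "touch E lev v t" for s t
        unfolding linked_def using xv x(2) touch_sym[OF that(1)] that(2) by blast
      then have "linked {..<n} E lev (fs x) (fs v)" "linked {..<n} E lev (ls x) (ls v)"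
        using fs[OF xv(1)] fs[OF xv(2)] ls[OF xv(1)] ls[OF xv(2)] by blast+
      then show ?thesis using kap_neq[of "fs x" "fs v"] kap_neq[of "ls x" "ls v"] fs ls xv x by auto
    qed
    ultimately have "fs u = fs v" "ls u = ls v" "fs w = fs v" "ls w = ls v" using V eq by auto
    then have "conflict E lev fs ls u w"
      using eq \<open>(u, w) \<notin> E\<close> \<open>u \<noteq> w\<close> by (simp add: conflict_def)
    then show False using par V eq by blast
  qed
  have "induces_disjoint_cliques G X" if X: "X \<in> color_classes (pverts G) (m ''col'')" for X
  proof -
    obtain x where "x < n" "X = {w \<in> {..<n}. m ''col'' w = m ''col'' x}"
      using X by (auto simp: color_classes_def V)
    then have "class_of m8 w = class_of m8 x \<and> w < n" if "w \<in> X" for w using that col by auto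
    then show ?thesis
      unfolding induces_disjoint_cliques_iff_no_induced_P3[OF pg] using clique E_def by metis
  qed
  then show "subcoloring G (output_partition G m)"
    by (simp add: subcoloring_def output_partition_def partition_on_color_classes)
  let ?\<chi> = "subchromatic_number G"
  have "output_partition G m = (\<lambda>c. {w \<in> {..<n}. class_of m8 w = c}) ` class_of m8 ` {..<n}"
    unfolding output_partition_def color_classes_def V image_image
    by (intro image_cong refl Collect_cong) (auto simp: col)
  then have "card (output_partition G m) \<le> card (class_of m8 ` {..<n})"
    by (simp add: card_image_le)
  \<comment> \<open>There are at most \<open>?\<chi>\<close> levels, 27 colors for each of
    \<open>fs v\<close> and \<open>ls v\<close>, and 2 parities;
    \<open>27 * 27 * 2 = 1458\<close>.\<close>
  also have "class_of m8 ` {..<n} \<subseteq> {..<?\<chi>} \<times> {..26} \<times> {..26} \<times> {..1}"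
    using lev_sub kap_bound fs ls par1 by (auto simp: cls)
  then have "card (class_of m8 ` {..<n}) \<le> card ({..<?\<chi>} \<times> {..26 :: nat} \<times> {..26 :: nat} \<times> {..1 :: nat})"
    by (intro card_mono) auto
  also have "\<dots> = 1458 * ?\<chi>" by (simp add: card_cartesian_product)
  finally show "card (output_partition G m) \<le> 1458 * ?\<chi>" .
qed

theorem theorem25:
  shows "\<exists>(c :: real) (p :: prog).
    solves_in_poly_time p
      {G :: nat pair_pre_digraph. delta_disk_graph G \<and> pverts G = {..<card (pverts G)}}
      order_of graph_input
      (\<lambda>G m. subcoloring G (output_partition G m) \<and>
             real (card (output_partition G m)) \<le> c * real (subchromatic_number G))"
proof (intro exI)
  show "solves_in_poly_time (compile 0 algorithm)
      {G :: nat pair_pre_digraph. delta_disk_graph G \<and> pverts G = {..<card (pverts G)}}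
      order_of graph_input
      (\<lambda>G m. subcoloring G (output_partition G m) \<and>
             real (card (output_partition G m)) \<le> 1458 * real (subchromatic_number G))"
  proof (rule loop_solves_in_poly_time)
    fix G :: "nat pair_pre_digraph"
    assume "G \<in> {G. delta_disk_graph G \<and> pverts G = {..<card (pverts G)}}"
    then have "delta_disk_graph G" "pverts G = {..<card (pverts G)}" by auto
    from algorithm_correct[OF this]
    have "subcoloring G (output_partition G (run algorithm [] (graph_input G)))"
      and "real (card (output_partition G (run algorithm [] (graph_input G)))) \<le>
        real (1458 * subchromatic_number G)"
      by (auto simp only: of_nat_le_iff)
    then show "subcoloring G (output_partition G (run algorithm [] (graph_input G))) \<and>
        real (card (output_partition G (run algorithm [] (graph_input G)))) \<le>
        1458 * real (subchromatic_number G)"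
      by simp
  qed (simp_all add: wf_algorithm graph_input_def output_partition_def)
qed

end
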